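(* For every positive integer $n$, $$\int_{\mathbb{Z}_p}[1-x]_{1/q}^{\,n}\,d\mu_{-q}(x)=q^2\int_{\mathbb{Z}_p}[x]_{1/q}^{\,n}\,d\mu_{-1/q}(x)+q+1=[2]_q+q^2\,\xi_{n,1/q}.$$
   Context: Let $p$ be an odd prime, $\mathbb{C}_p$ the completion of an algebraic closure of $\mathbb{Q}_p$, and $q\in\mathbb{C}_p$ with $|1-q|_p<1$ (then also $|1-q^{-1}|_p<1$). For $Q\in\{q,q^{-1}\}$ put $[x]_Q=\frac{1-Q^x}{1-Q}$, $[x]_{-Q}=\frac{1-(-Q)^x}{1+Q}$; in particular $[2]_q=1+q$. For a uniformly differentiable function $f:\mathbb{Z}_p\to\mathbb{C}_p$, the fermionic $p$-adic $Q$-integral is $\int_{\mathbb{Z}_p}f(x)\,d\mu_{-Q}(x)=\lim_{N\to\infty}\frac{1}{[p^N]_{-Q}}\sum_{x=0}^{p^N-1}f(x)(-Q)^x$. The $Q$-Euler numbers $\xi_{n,Q}$ are defined by $\xi_{0,Q}=1$ and, for $n\ge 1$, $Q\sum_{l=0}^{n}\binom{n}{l}Q^l\xi_{l,Q}+\xi_{n,Q}=0$; $\xi_{n,1/q}$ denotes these numbers for $Q=q^{-1}$. *)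

theory Defs
  imports "HOL-Analysis.Analysis" "HOL-Algebra.Algebraic_Closure_Type"
begin

section \<open>The field of $p$-adic complex numbers\<close>

locale nonarch_absolute_value =
  fixes v :: "'a :: field \<Rightarrow> real"
  assumes nonneg: "0 \<le> v x"
    and eq_0_iff: "v x = 0 \<longleftrightarrow> x = 0"
    and mult: "v (x * y) = v x * v y"
    and ultrametric: "v (x + y) \<le> max (v x) (v y)"

abbreviation (input) vdist :: "('a :: field \<Rightarrow> real) \<Rightarrow> 'a \<Rightarrow> 'a \<Rightarrow> real" where
  "vdist v \<equiv> \<lambda>x y. v (x - y)"

abbreviation vtopology :: "('a :: field \<Rightarrow> real) \<Rightarrow> 'a topology" where
  "vtopology v \<equiv> Metric_space.mtopology UNIV (vdist v)"

definition padic_abs :: "nat \<Rightarrow> rat \<Rightarrow> real" where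
  "padic_abs p r = (if r = 0 then 0 else
     real p powi (int (multiplicity (int p) (snd (quotient_of r)))
                - int (multiplicity (int p) (fst (quotient_of r)))))"

definition Qp :: "('a :: field_char_0 \<Rightarrow> real) \<Rightarrow> 'a set" where
  "Qp v = vtopology v closure_of (range of_rat)"

definition Zp :: "('a :: field_char_0 \<Rightarrow> real) \<Rightarrow> 'a set" where
  "Zp v = {x \<in> Qp v. v x \<le> 1}"

text \<open>
  A type with an absolute value \<open>v\<close> that is a completion of an algebraic closure \<open>A\<close> of
  \<open>\<rat>\<^sub>p\<close>. The fields \<open>\<rat>\<^sub>p\<close> and \<open>A\<close> are subfields of the type: completeness makes
  the closure of \<open>\<rat>\<close> in it a completion of \<open>\<rat>\<close> for the \<open>p\<close>-adic absolute value. These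
  data determine the type up to isometric isomorphism.
\<close>
locale padic_complex_field = nonarch_absolute_value v
  for v :: "'a :: field_char_0 \<Rightarrow> real" +
  fixes p :: nat
  assumes prime_p: "Factorial_Ring.prime p"
    and v_of_rat: "v (of_rat r) = padic_abs p r"
    and complete: "Metric_space.mcomplete UNIV (vdist v)"
    and dense_algebraic_closure:
      "\<exists>A. algebraic_closure ((ring_of_type_algebra :: 'a ring)\<lparr>carrier := A\<rparr>) (Qp v) \<and>
           vtopology v closure_of A = UNIV"


section \<open>Fermionic $p$-adic $Q$-integrals\<close>

text \<open>\<open>Q\<^sup>x\<close> for \<open>x \<in> \<int>\<^sub>p\<close> and \<open>|1 - Q| < 1\<close>: the continuous extension of \<open>n \<mapsto> Q\<^sup>n\<close>
  from \<open>\<nat>\<close> to \<open>\<int>\<^sub>p\<close>.\<close>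
definition zp_power :: "('a :: field_char_0 \<Rightarrow> real) \<Rightarrow> 'a \<Rightarrow> 'a \<Rightarrow> 'a" where
  "zp_power v Q x = (THE L. \<forall>s :: nat \<Rightarrow> nat.
     limitin (vtopology v) (\<lambda>k. of_nat (s k)) x sequentially \<longrightarrow>
     limitin (vtopology v) (\<lambda>k. Q ^ s k) L sequentially)"

text \<open>\<open>[x]\<^sub>Q\<close>; at \<open>Q = 1\<close> the quotient \<open>(1 - Q\<^sup>x) / (1 - Q)\<close> is read as its limit \<open>x\<close>.\<close>
definition q_bracket :: "('a :: field_char_0 \<Rightarrow> real) \<Rightarrow> 'a \<Rightarrow> 'a \<Rightarrow> 'a" where
  "q_bracket v Q x = (if Q = 1 then x else (1 - zp_power v Q x) / (1 - Q))"

text \<open>\<open>[m]\<^bsub>-Q\<^esub>\<close>, needed for natural numbers \<open>m\<close> only.\<close>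
definition neg_bracket :: "'a :: field \<Rightarrow> nat \<Rightarrow> 'a" where
  "neg_bracket Q m = (1 - (- Q) ^ m) / (1 + Q)"

definition uniformly_differentiable_Zp ::
    "('a :: field_char_0 \<Rightarrow> real) \<Rightarrow> ('a \<Rightarrow> 'a) \<Rightarrow> bool" where
  "uniformly_differentiable_Zp v f \<longleftrightarrow>
     (\<exists>f'. \<forall>e>0. \<exists>d>0. \<forall>x\<in>Zp v. \<forall>y\<in>Zp v.
        x \<noteq> y \<and> v (x - y) < d \<longrightarrow> v ((f x - f y) / (x - y) - f' x) < e)"

definition has_fermionic_integral ::
    "('a :: field_char_0 \<Rightarrow> real) \<Rightarrow> nat \<Rightarrow> 'a \<Rightarrow> ('a \<Rightarrow> 'a) \<Rightarrow> 'a \<Rightarrow> bool" where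
  "has_fermionic_integral v p Q f I \<longleftrightarrow>
     uniformly_differentiable_Zp v f \<and>
     limitin (vtopology v)
       (\<lambda>N. 1 / neg_bracket Q (p ^ N) * (\<Sum>x<p ^ N. f (of_nat x) * (- Q) ^ x)) I sequentially"

definition fermionic_integrable ::
    "('a :: field_char_0 \<Rightarrow> real) \<Rightarrow> nat \<Rightarrow> 'a \<Rightarrow> ('a \<Rightarrow> 'a) \<Rightarrow> bool" where
  "fermionic_integrable v p Q f \<longleftrightarrow> (\<exists>I. has_fermionic_integral v p Q f I)"

definition fermionic_integral ::
    "('a :: field_char_0 \<Rightarrow> real) \<Rightarrow> nat \<Rightarrow> 'a \<Rightarrow> ('a \<Rightarrow> 'a) \<Rightarrow> 'a" where
  "fermionic_integral v p Q f = (THE I. has_fermionic_integral v p Q f I)"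


section \<open>The $Q$-Euler numbers\<close>

text \<open>The defining equation solved for \<open>\<xi>\<^sub>n\<close>, whose total coefficient is \<open>1 + Q\<^bsup>n+1\<^esup>\<close>;
  the lemma \<open>q_euler_unique\<close> below recovers the implicit definition.\<close>
fun q_euler :: "'a :: field \<Rightarrow> nat \<Rightarrow> 'a" where
  "q_euler Q n = (if n = 0 then 1 else
     - Q * (\<Sum>l<n. of_nat (n choose l) * Q ^ l * q_euler Q l) / (1 + Q ^ (n + 1)))"

declare q_euler.simps [simp del]

lemma q_euler_unique:
  fixes Q :: "'a :: field"
  assumes nz: "\<And>n. 1 + Q ^ (n + 1) \<noteq> 0"
  shows "\<xi> = q_euler Q \<longleftrightarrow>
    \<xi> 0 = 1 \<and>
    (\<forall>n\<ge>1. Q * (\<Sum>l=0..n. of_nat (n choose l) * Q ^ l * \<xi> l) + \<xi> n = 0)"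
proof -
  have step: "Q * (\<Sum>l=0..n. of_nat (n choose l) * Q ^ l * \<eta> l) + \<eta> n = 0 \<longleftrightarrow>
      \<eta> n = - Q * (\<Sum>l<n. of_nat (n choose l) * Q ^ l * \<eta> l) / (1 + Q ^ (n + 1))"
    for \<eta> :: "nat \<Rightarrow> 'a" and n
  proof -
    let ?S = "\<Sum>l<n. of_nat (n choose l) * Q ^ l * \<eta> l"
    have "(\<Sum>l=0..n. of_nat (n choose l) * Q ^ l * \<eta> l) = ?S + Q ^ n * \<eta> n"
      by (simp add: atLeast0AtMost lessThan_Suc_atMost [symmetric])
    then have "Q * (\<Sum>l=0..n. of_nat (n choose l) * Q ^ l * \<eta> l) + \<eta> n
        = \<eta> n * (1 + Q ^ (n + 1)) - (- Q * ?S)"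
      by (simp add: algebra_simps)
    then show ?thesis
      using nz [of n] by (simp only: eq_divide_eq) (simp add: eq_neg_iff_add_eq_0)
  qed
  show ?thesis
  proof
    assume eq: "\<xi> = q_euler Q"
    have "\<xi> n = - Q * (\<Sum>l<n. of_nat (n choose l) * Q ^ l * \<xi> l) / (1 + Q ^ (n + 1))"
      if "n \<ge> 1" for n
      using that unfolding eq by (subst q_euler.simps) simp
    then show "\<xi> 0 = 1 \<and>
        (\<forall>n\<ge>1. Q * (\<Sum>l=0..n. of_nat (n choose l) * Q ^ l * \<xi> l) + \<xi> n = 0)"
      unfolding step by (simp add: eq q_euler.simps [of Q 0])
  next
    assume R: "\<xi> 0 = 1 \<and>
        (\<forall>n\<ge>1. Q * (\<Sum>l=0..n. of_nat (n choose l) * Q ^ l * \<xi> l) + \<xi> n = 0)"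
    have "\<xi> n = q_euler Q n" for n
    proof (induction n rule: less_induct)
      case (less n)
      show ?case
      proof (cases "n = 0")
        case True
        then show ?thesis using R by (simp add: q_euler.simps [of Q 0])
      next
        case False
        then have "\<xi> n = - Q * (\<Sum>l<n. of_nat (n choose l) * Q ^ l * \<xi> l) / (1 + Q ^ (n + 1))"
          using R step [where n = n and \<eta> = \<xi>] by simp
        also have "\<dots> = q_euler Q n"
          using False less by (subst q_euler.simps) simp
        finally show ?thesis .
      qed
    qed
    then show "\<xi> = q_euler Q" by blast
  qed
qed

text \<open>The hypothesis of \<open>q_euler_unique\<close> holds whenever \<open>p\<close> is odd and \<open>|1 - Q| < 1\<close>.\<close>
lemma (in padic_complex_field) one_plus_power_nonzero:
  assumes "odd p" and Q: "v (1 - Q) < 1"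
  shows "1 + Q ^ n \<noteq> 0"
proof
  assume 0: "1 + Q ^ n = 0"
  have v1: "v 1 = 1"
    using mult [of 1 1] eq_0_iff [of 1] by simp
  have "v (-1) * v (-1) = 1"
    using mult [of "-1" "-1"] v1 by simp
  then have vm1: "v (-1) = 1"
    using nonneg [of "-1"] by (metis abs_of_nonneg power2_eq_1_iff power2_eq_square abs_1 abs_minus_cancel)
  have "v Q \<le> 1"
    using ultrametric [of 1 "- (1 - Q)"] mult [of "-1" "1 - Q"] Q v1 vm1 by simp
  have "v (1 - Q ^ n) < 1"
  proof (induction n)
    case 0
    show ?case using eq_0_iff [of 0] by simp
  next
    case (Suc n)
    have "v (Q * (1 - Q ^ n)) < 1"
      using mult [of Q "1 - Q ^ n"] \<open>v Q \<le> 1\<close> Suc nonneg [of Q] nonneg [of "1 - Q ^ n"]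
      by (metis mult_left_le_one_le order_le_less_trans)
    moreover have "1 - Q ^ Suc n = (1 - Q) + Q * (1 - Q ^ n)"
      by (simp add: algebra_simps)
    ultimately show ?case
      using ultrametric [of "1 - Q" "Q * (1 - Q ^ n)"] Q by (metis max_less_iff_conj order_le_less_trans)
  qed
  moreover have "1 - Q ^ n = of_rat 2"
    using 0 by (simp add: eq_neg_iff_add_eq_0 [symmetric] add_eq_0_iff)
  moreover have "padic_abs p 2 = 1"
  proof -
    have "\<not> int p dvd 2"
    proof
      assume "int p dvd 2"
      then have "p dvd 2"
        by (metis int_dvd_int_iff of_nat_numeral)
      then have "p = 2"
        using prime_p by (simp add: primes_dvd_imp_eq)
      then show False
        using \<open>odd p\<close> by simp
    qed
    then have "multiplicity (int p) 2 = 0"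
      by (rule not_dvd_imp_multiplicity_0)
    then show ?thesis
      by (simp add: padic_abs_def)
  qed
  ultimately show False
    using v_of_rat [of 2] by simp
qed

end

theory Submission
  imports Defs "HOL-Number_Theory.Cong"
begin

text \<open>
  Write \<open>S\<^sub>N f\<close> for the sum of \<open>f(x) (-Q)\<^sup>x\<close> over \<open>0 \<le> x < p\<^sup>N\<close>. Telescoping gives
  \<open>Q S\<^sub>N(f(x+1)) + S\<^sub>N(f) = f(0) + f(p\<^sup>N) Q\<^bsup>p^N\<^esup>\<close>, which tends to \<open>2 f(0)\<close> for continuous \<open>f\<close>.
  Put \<open>R = 1/q\<close>. Since \<open>[x+1]\<^sub>R = 1 + R [x]\<^sub>R\<close>, taking \<open>Q = R\<close> and \<open>f = [x]\<^sub>R\<^sup>n\<close> shows that the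
  limits of the sums satisfy the recurrence of the \<open>R\<close>-Euler numbers, up to the factor \<open>2/(1+R)\<close>.
  Taking \<open>Q = q\<close> and \<open>f = [1-x]\<^sub>R\<^sup>n\<close> gives the same recurrence with a different right-hand side,
  whose solution is \<open>2/(1+q) (1 + q + q\<^sup>2 \<xi>\<^sub>n)\<close> for \<open>n \<ge> 1\<close>. This argument needs no case
  distinction at \<open>q = 1\<close>. Uniform differentiability of \<open>Q\<^sup>x\<close> comes from the estimate
  \<open>|Q\<^sup>m - 1 - m (Q - 1)| \<le> |Q - 1|\<^sup>2\<close>, applied to the powers \<open>Q\<^bsup>p^k\<^esup>\<close>.
\<close>

section \<open>Limits for a non-archimedean absolute value\<close>

context nonarch_absolute_value
begin

section \<open>Elementary properties of the absolute value\<close>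

lemma v_0 [simp]: "v 0 = 0"
  by (simp add: eq_0_iff)

lemma v_1 [simp]: "v 1 = 1"
  using mult [of 1 1] eq_0_iff [of 1] by simp

lemma v_pos: "x \<noteq> 0 \<Longrightarrow> 0 < v x"
  using nonneg [of x] eq_0_iff [of x] by linarith

lemma v_minus [simp]: "v (- x) = v x"
proof -
  have "v (-1) * v (-1) = 1"
    using mult [of "-1" "-1"] by simp
  then have "v (-1) = 1"
    using nonneg [of "-1"] by (metis abs_of_nonneg power2_eq_1_iff power2_eq_square abs_1 abs_minus_cancel)
  then show ?thesis
    using mult [of "-1" x] by simp
qed

lemma v_minus_commute: "v (x - y) = v (y - x)"
  using v_minus [of "x - y"] by simp

lemma v_power: "v (x ^ k) = v x ^ k"
  by (induction k) (simp_all add: mult)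

lemma v_divide: "v (x / y) = v x / v y"
proof (cases "y = 0")
  case False
  then have "v (x / y) * v y = v x"
    by (simp flip: mult)
  then show ?thesis
    using v_pos [OF False] by (simp add: field_simps)
qed simp

lemma v_add_le: "v x \<le> c \<Longrightarrow> v y \<le> c \<Longrightarrow> v (x + y) \<le> c"
  using ultrametric [of x y] by simp

lemma v_diff_le: "v x \<le> c \<Longrightarrow> v y \<le> c \<Longrightarrow> v (x - y) \<le> c"
  using v_add_le [of x c "- y"] by simp

lemma v_add_less: "v x < c \<Longrightarrow> v y < c \<Longrightarrow> v (x + y) < c"
  using ultrametric [of x y] by linarith

lemma v_diff_less: "v x < c \<Longrightarrow> v y < c \<Longrightarrow> v (x - y) < c"
  using v_add_less [of x c "- y"] by simp

lemma v_triangle: "v (x + y) \<le> v x + v y"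
  using ultrametric [of x y] nonneg [of x] nonneg [of y] by linarith

lemma v_sum_le:
  assumes "\<And>i. i \<in> A \<Longrightarrow> v (f i) \<le> c" "0 \<le> c"
  shows "v (sum f A) \<le> c"
  using assms by (induction A rule: infinite_finite_induct) (auto intro: v_add_le)

lemma v_of_nat_le_1: "v (of_nat k) \<le> 1"
  by (induction k) (auto intro: v_add_le)

text \<open>Since \<open>1 = Q + (1 - Q)\<close>, having |Q| < 1 would force |1| < 1. Hence
  multiplication by powers of \<open>Q\<close> preserves absolute values, so such powers can be
  factored out of estimates.\<close>

lemma v_eq_1:
  assumes "v (1 - Q) < 1"
  shows "v Q = 1"
proof (rule antisym)
  show "v Q \<le> 1"
    using v_diff_le [of 1 1 "1 - Q"] assms by simp
  show "1 \<le> v Q"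
    using v_add_less [of Q 1 "1 - Q"] assms by fastforce
qed

section \<open>The metric and convergence of sequences\<close>

lemma Metric_space_vdist: "Metric_space UNIV (vdist v)"
proof
  fix x y z :: 'a
  show "v (x - z) \<le> v (x - y) + v (y - z)"
    using v_triangle [of "x - y" "y - z"] by simp
qed (auto simp: nonneg v_minus_commute eq_0_iff)

text \<open>Encoded as a real null sequence so that the limit calculus for reals carries over;
  \<open>limitin_vtopology_iff\<close> links it to the topology.\<close>

definition vlim :: "(nat \<Rightarrow> 'a) \<Rightarrow> 'a \<Rightarrow> bool" where
  "vlim s L \<longleftrightarrow> (\<lambda>k. v (s k - L)) \<longlonglongrightarrow> 0"

lemma vlim_iff: "vlim s L \<longleftrightarrow> (\<forall>e>0. \<exists>N. \<forall>k\<ge>N. v (s k - L) < e)"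
  by (simp add: vlim_def LIMSEQ_def nonneg)

lemma limitin_vtopology_iff: "limitin (vtopology v) s L sequentially \<longleftrightarrow> vlim s L"
  by (simp add: Metric_space.limit_metric_sequentially [OF Metric_space_vdist] vlim_iff)

lemma vlim_unique: "vlim s L \<Longrightarrow> vlim s L' \<Longrightarrow> L = L'"
  unfolding limitin_vtopology_iff [symmetric]
  using Metric_space.limitin_metric_unique [OF Metric_space_vdist] by fastforce

lemma vlim_squeeze: "(\<And>k. v (s k - L) \<le> g k) \<Longrightarrow> g \<longlonglongrightarrow> 0 \<Longrightarrow> vlim s L"
  unfolding vlim_def by (rule Lim_null_comparison [where g = g]) (simp_all add: nonneg)

lemma vlim_const [simp]: "vlim (\<lambda>_. c) c"
  by (simp add: vlim_def)

lemma vlim_add: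
  assumes "vlim s L" "vlim t M"
  shows "vlim (\<lambda>k. s k + t k) (L + M)"
proof (rule vlim_squeeze)
  show "v (s k + t k - (L + M)) \<le> v (s k - L) + v (t k - M)" for k
    using v_triangle [of "s k - L" "t k - M"] by (simp add: algebra_simps)
  show "(\<lambda>k. v (s k - L) + v (t k - M)) \<longlonglongrightarrow> 0"
    using assms unfolding vlim_def by (rule tendsto_add_zero)
qed

lemma vlim_v:
  assumes "vlim s L"
  shows "(\<lambda>k. v (s k)) \<longlonglongrightarrow> v L"
proof (rule Lim_transform)
  show "(\<lambda>k. v (s k) - v L) \<longlonglongrightarrow> 0"
  proof (rule Lim_null_comparison)
    show "(\<lambda>k. v (s k - L)) \<longlonglongrightarrow> 0"
      using assms by (simp add: vlim_def)
    show "\<forall>\<^sub>F k in sequentially. norm (v (s k) - v L) \<le> v (s k - L)"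
    proof (rule always_eventually, rule allI)
      fix k
      show "norm (v (s k) - v L) \<le> v (s k - L)"
        using v_triangle [of "s k - L" L] v_triangle [of "L - s k" "s k"] v_minus_commute [of L "s k"]
        by simp
    qed
  qed
qed simp

lemma vlim_mult:
  assumes "vlim s L" "vlim t M"
  shows "vlim (\<lambda>k. s k * t k) (L * M)"
proof (rule vlim_squeeze)
  show "v (s k * t k - L * M) \<le> v (s k - L) * v (t k) + v L * v (t k - M)" for k
    using v_triangle [of "(s k - L) * t k" "L * (t k - M)"] by (simp add: left_diff_distrib right_diff_distrib flip: mult)
  have "(\<lambda>k. v (s k - L) * v (t k) + v L * v (t k - M)) \<longlonglongrightarrow> 0 * v M + v L * 0"
    using assms vlim_v [OF assms(2)] unfolding vlim_def by (intro tendsto_intros)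
  then show "(\<lambda>k. v (s k - L) * v (t k) + v L * v (t k - M)) \<longlonglongrightarrow> 0"
    by simp
qed

lemma vlim_cmult: "vlim s L \<Longrightarrow> vlim (\<lambda>k. c * s k) (c * L)"
  by (rule vlim_mult [OF vlim_const])

lemma vlim_minus: "vlim s L \<Longrightarrow> vlim (\<lambda>k. - s k) (- L)"
  using vlim_cmult [of s L "-1"] by simp

lemma vlim_diff: "vlim s L \<Longrightarrow> vlim t M \<Longrightarrow> vlim (\<lambda>k. s k - t k) (L - M)"
  using vlim_add [OF _ vlim_minus] by fastforce

lemma vlim_power: "vlim s L \<Longrightarrow> vlim (\<lambda>k. s k ^ n) (L ^ n)"
  by (induction n) (auto intro: vlim_mult)

lemma vlim_sum: "(\<And>i. i \<in> A \<Longrightarrow> vlim (s i) (L i)) \<Longrightarrow> vlim (\<lambda>k. \<Sum>i\<in>A. s i k) (\<Sum>i\<in>A. L i)"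
  by (induction A rule: infinite_finite_induct) (auto intro: vlim_add)

lemma vlim_divide:
  assumes s: "vlim s L" and t: "vlim t M" and M: "M \<noteq> 0" and nz: "\<And>k. t k \<noteq> 0"
  shows "vlim (\<lambda>k. s k / t k) (L / M)"
proof -
  have "vlim (\<lambda>k. 1 / t k) (1 / M)"
  proof (rule vlim_squeeze)
    show "v (1 / t k - 1 / M) \<le> v (t k - M) / (v (t k) * v M)" for k
    proof -
      have "1 / t k - 1 / M = (M - t k) / (t k * M)"
        using M nz by (simp add: field_simps)
      then show ?thesis
        by (simp add: v_divide mult v_minus_commute)
    qed
    have "(\<lambda>k. v (t k - M) / (v (t k) * v M)) \<longlonglongrightarrow> 0 / (v M * v M)"
      using t vlim_v [OF t] M unfolding vlim_def by (intro tendsto_intros) (auto simp: eq_0_iff)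
    then show "(\<lambda>k. v (t k - M) / (v (t k) * v M)) \<longlonglongrightarrow> 0"
      by simp
  qed
  from vlim_mult [OF s this] show ?thesis
    by simp
qed

text \<open>By the ultrametric inequality, vanishing of the consecutive differences already makes a
  sequence Cauchy.\<close>
lemma convergent_if_diff_null:
  assumes complete: "Metric_space.mcomplete UNIV (vdist v)"
    and null: "(\<lambda>k. v (s (Suc k) - s k)) \<longlonglongrightarrow> 0"
  obtains L where "vlim s L"
proof -
  have "Metric_space.MCauchy UNIV (vdist v) s"
    unfolding Metric_space.MCauchy_def [OF Metric_space_vdist]
  proof (intro conjI allI impI)
    fix e :: real assume "e > 0"
    with null obtain N where N: "v (s (Suc k) - s k) < e" if "k \<ge> N" for k
      by (auto simp: LIMSEQ_def nonneg)
    have *: "v (s (N + j) - s N) < e" for j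
    proof (induction j)
      case 0
      show ?case using \<open>e > 0\<close> by simp
    next
      case (Suc j)
      show ?case
        using v_add_less [OF N [of "N + j"] Suc] by simp
    qed
    have "v (s m - s n) < e" if "N \<le> m" "N \<le> n" for m n
      using v_diff_less [OF * [of "m - N"] * [of "n - N"]] that by simp
    then show "\<exists>N. \<forall>n n'. N \<le> n \<longrightarrow> N \<le> n' \<longrightarrow> v (s n - s n') < e"
      by blast
  qed simp
  then show thesis
    using complete that unfolding Metric_space.mcomplete_def [OF Metric_space_vdist]
    by (auto simp: limitin_vtopology_iff)
qed

section \<open>Expansion of powers near 1\<close>

lemma v_power_le_1: "v Q \<le> 1 \<Longrightarrow> v (Q ^ k) \<le> 1"
  by (simp add: v_power nonneg power_le_one)

lemma v_power_minus_1_le: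
  assumes "v Q \<le> 1"
  shows "v (Q ^ m - 1) \<le> v (Q - 1)"
proof -
  have "v (\<Sum>i<m. Q ^ i) \<le> 1"
    using assms by (intro v_sum_le) (auto intro: v_power_le_1)
  then show ?thesis
    by (simp add: power_diff_1_eq mult mult_left_le nonneg)
qed

text \<open>The geometric sum is used twice: it gives the factorization
  \<open>(Q - 1) * (\<Sum>i<m. Q ^ i - 1)\<close>, and each summand is again bounded by |Q -
  1|.\<close>

lemma v_power_minus_linear_le:
  assumes "v Q \<le> 1"
  shows "v (Q ^ m - 1 - of_nat m * (Q - 1)) \<le> (v (Q - 1))\<^sup>2"
proof -
  have "Q ^ m - 1 - of_nat m * (Q - 1) = (Q - 1) * (\<Sum>i<m. Q ^ i - 1)"
    by (simp add: power_diff_1_eq [of Q m] sum_subtractf algebra_simps)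
  moreover have "v (\<Sum>i<m. Q ^ i - 1) \<le> v (Q - 1)"
    using assms by (intro v_sum_le) (auto intro: v_power_minus_1_le simp: nonneg)
  ultimately show ?thesis
    by (simp add: mult power2_eq_square mult_left_mono nonneg)
qed

end

section \<open>Powers with $p$-adic integer exponents\<close>

context padic_complex_field
begin

section \<open>Absolute values of integers and decay of \<open>Q ^ p ^ k - 1\<close>\<close>

lemma v_of_int:
  assumes "a \<noteq> 0"
  shows "v (of_int a) = 1 / real p ^ multiplicity (int p) a"
  using v_of_rat [of "of_int a"] assms
  by (simp add: padic_abs_def power_int_minus field_simps)

lemma p_gt_1: "1 < p"
  using prime_p prime_gt_1_nat by blast

lemma v_p_power: "v (of_nat (p ^ k)) = 1 / real p ^ k"
proof -
  have "multiplicity (int p) (int p) = 1"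
    using p_gt_1 by (simp add: multiplicity_self)
  then have "v (of_int (int p)) = 1 / real p"
    using p_gt_1 by (subst v_of_int) auto
  then show ?thesis
    by (simp add: v_power power_divide)
qed

lemma v_of_int_eq_1: "\<not> int p dvd a \<Longrightarrow> v (of_int a) = 1"
  by (subst v_of_int) (auto simp: not_dvd_imp_multiplicity_0)

lemma v_of_int_le_1: "v (of_int a) \<le> 1"
  by (cases a) (simp_all only: of_int_minus of_int_of_nat_eq v_minus v_of_nat_le_1)

lemma v_p_power_null: "(\<lambda>k. v (of_nat (p ^ k))) \<longlonglongrightarrow> 0"
  unfolding v_p_power using p_gt_1 by (intro LIMSEQ_divide_realpow_zero) simp

text \<open>For \<open>R = Q ^ p ^ k\<close>, the difference \<open>R ^ p - 1\<close> equals
  \<open>p * (R - 1)\<close> up to an error of size |R - 1|^2. Each p-th power therefore contracts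
  the distance to 1 by the factor \<open>c\<close> below.\<close>

lemma power_p_power_null:
  assumes Q: "v (1 - Q) < 1"
  shows "(\<lambda>k. v (Q ^ p ^ k - 1)) \<longlonglongrightarrow> 0"
proof -
  \<comment> \<open>The entries bound the linear term, as |p| = 1/p, and the quadratic error, as |R
    - 1| <= |1 - Q|.\<close>
  define c where "c = max (1 / p) (v (1 - Q))"
  have c: "0 \<le> c" "c < 1"
    using Q p_gt_1 by (simp_all add: c_def le_max_iff_disj nonneg)
  have vQ: "v (Q ^ j) \<le> 1" for j
    using v_eq_1 [OF Q] by (simp add: v_power)
  have "v (Q ^ p ^ k - 1) \<le> c ^ Suc k" for k
  proof (induction k)
    case 0
    show ?case by (simp add: c_def v_minus_commute)
  next
    case (Suc k)
    define R where "R = Q ^ p ^ k"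
    have R: "v (R - 1) \<le> c"
      using v_power_minus_1_le [of Q "p ^ k"] vQ [of 1] by (simp add: R_def c_def v_minus_commute)
    have "v ((R ^ p - 1 - of_nat p * (R - 1)) + of_nat p * (R - 1)) \<le> c * v (R - 1)"
    proof (rule v_add_le)
      have "v (R ^ p - 1 - of_nat p * (R - 1)) \<le> (v (R - 1))\<^sup>2"
        using vQ by (intro v_power_minus_linear_le) (simp add: R_def)
      also have "\<dots> \<le> c * v (R - 1)"
        using R by (simp add: power2_eq_square mult_right_mono nonneg)
      finally show "v (R ^ p - 1 - of_nat p * (R - 1)) \<le> c * v (R - 1)" .
      show "v (of_nat p * (R - 1)) \<le> c * v (R - 1)"
        using v_p_power [of 1] by (simp add: mult c_def mult_right_mono nonneg del: times_divide_eq_left)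
    qed
    also have "\<dots> \<le> c * c ^ Suc k"
      using Suc c by (simp add: R_def mult_left_mono)
    finally have "v (R ^ p - 1) \<le> c ^ Suc (Suc k)"
      by simp
    moreover have "R ^ p = Q ^ p ^ Suc k"
      by (simp add: R_def mult.commute flip: power_mult)
    ultimately show ?case
      by simp
  qed
  then have "\<forall>\<^sub>F k in sequentially. norm (v (Q ^ p ^ k - 1)) \<le> c ^ Suc k"
    by (simp add: nonneg del: power_Suc)
  moreover have "(\<lambda>k. c ^ Suc k) \<longlonglongrightarrow> 0"
    using c by (intro LIMSEQ_Suc LIMSEQ_power_zero) simp
  ultimately show ?thesis
    by (rule Lim_null_comparison)
qed

text \<open>\<open>L\<close> is the \<open>p\<close>-adic logarithm of \<open>Q\<close>, obtained as the limit of \<open>(Q\<^bsup>p^k\<^esup> - 1) / p\<^sup>k\<close>.\<close>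
lemma power_derivative_at_0:
  assumes Q: "v (1 - Q) < 1"
  obtains L where "\<And>e. e > 0 \<Longrightarrow> \<exists>d>0. \<forall>h. v (of_nat h) < d \<longrightarrow>
    v (Q ^ h - 1 - L * of_nat h) \<le> e * v (of_nat h)"
proof -
  define w where "w k = v (Q ^ p ^ k - 1)" for k
  define u where "u k = (Q ^ p ^ k - 1) / of_nat (p ^ k)" for k
  have p0: "(of_nat p :: 'a) \<noteq> 0" "real p > 0" "p > 0"
    using p_gt_1 by auto
  have w: "w \<longlonglongrightarrow> 0"
    using power_p_power_null [OF Q] by (simp add: w_def [abs_def])
  have vQ: "v (Q ^ j) \<le> 1" for j
    using v_eq_1 [OF Q] by (simp add: v_power)
  have uw: "v (u k) = w k * real p ^ k" for k
    using v_p_power [of k] by (simp add: u_def w_def v_divide del: of_nat_power)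
  have Qu: "Q ^ p ^ k - 1 = u k * of_nat (p ^ k)" for k
    using p0 by (simp add: u_def)
  \<comment> \<open>The right-hand side is \<open>(w k)\<^sup>2\<close> with a factor |p^k| made
    explicit, ready for division by \<open>p ^ Suc k\<close> and for comparison with |h|.\<close>
  have lin: "v ((Q ^ p ^ k) ^ m - 1 - of_nat m * (Q ^ p ^ k - 1)) \<le> v (u k) * w k * v (of_nat (p ^ k))" for k m
  proof -
    have "v (u k) * w k * v (of_nat (p ^ k)) = (w k)\<^sup>2"
      unfolding uw v_p_power using p0 by (simp add: power2_eq_square field_simps)
    then show ?thesis
      using v_power_minus_linear_le [of "Q ^ p ^ k" m] vQ [of "p ^ k"] by (simp add: w_def)
  qed
  have du: "v (u (Suc k) - u k) \<le> real p * (v (u k) * w k)" for k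
  proof -
    have "u (Suc k) - u k = ((Q ^ p ^ k) ^ p - 1 - of_nat p * (Q ^ p ^ k - 1)) / of_nat (p ^ Suc k)"
      using p0 by (simp add: u_def field_simps flip: power_mult)
    then have "v (u (Suc k) - u k) = v ((Q ^ p ^ k) ^ p - 1 - of_nat p * (Q ^ p ^ k - 1)) * real p ^ Suc k"
      using v_p_power [of "Suc k"] by (simp only: v_divide) simp
    also have "\<dots> \<le> v (u k) * w k * v (of_nat (p ^ k)) * real p ^ Suc k"
      by (intro mult_right_mono lin) simp
    also have "\<dots> = real p * (v (u k) * w k)"
      unfolding v_p_power using p0 by simp
    finally show ?thesis .
  qed
  \<comment> \<open>From \<open>K\<close> on, \<open>du\<close> yields |u (k+1) - u k| <= |u k|, so
    \<open>u\<close> stays bounded by |u K|. With this bound, \<open>du\<close> makes the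
    differences null because \<open>w\<close> tends to 0.\<close>
  obtain K where K: "w k \<le> 1 / p" if "k \<ge> K" for k
    using order_tendstoD(2) [OF w, of "1 / p"] p0
    by (auto simp: eventually_sequentially intro: less_imp_le)
  have bound: "v (u (K + j)) \<le> v (u K)" for j
  proof (induction j)
    case (Suc j)
    have "real p * (v (u (K + j)) * w (K + j)) \<le> real p * (v (u (K + j)) * (1 / p))"
      using K [of "K + j"] by (intro mult_left_mono) (auto simp: nonneg)
    then have "v (u (Suc (K + j)) - u (K + j)) \<le> v (u (K + j))"
      using du [of "K + j"] p0 by simp
    then have "v (u (Suc (K + j)) - u (K + j) + u (K + j)) \<le> v (u (K + j))"
      by (intro v_add_le) auto
    then show ?case
      using Suc by simp
  qed simp
  have "(\<lambda>k. v (u (Suc k) - u k)) \<longlonglongrightarrow> 0"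
  proof (rule Lim_null_comparison)
    show "\<forall>\<^sub>F k in sequentially. norm (v (u (Suc k) - u k)) \<le> real p * v (u K) * w k"
      unfolding eventually_sequentially
    proof (intro exI allI impI)
      fix k assume "K \<le> k"
      then have "v (u k) \<le> v (u K)"
        using bound [of "k - K"] by simp
      then have "real p * (v (u k) * w k) \<le> real p * (v (u K) * w k)"
        by (intro mult_left_mono mult_right_mono) (auto simp: w_def nonneg)
      then show "norm (v (u (Suc k) - u k)) \<le> real p * v (u K) * w k"
        using du [of k] by (simp add: nonneg mult.assoc)
    qed
    show "(\<lambda>k. real p * v (u K) * w k) \<longlonglongrightarrow> 0"
      using tendsto_mult_right_zero [OF w] .
  qed
  then obtain L where L: "vlim u L"
    using convergent_if_diff_null [OF complete] by blast
  show thesis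
  proof (rule that [of L])
    fix e :: real assume e: "e > 0"
    have "(\<lambda>k. v (u k) * w k) \<longlonglongrightarrow> v L * 0"
      using vlim_v [OF L] w by (rule tendsto_mult)
    then have "\<forall>\<^sub>F k in sequentially. v (u k) * w k < e"
      using e by (intro order_tendstoD(2)) auto
    moreover have "\<forall>\<^sub>F k in sequentially. v (u k - L) < e"
      using L e unfolding vlim_def by (rule order_tendstoD(2))
    ultimately have "\<forall>\<^sub>F k in sequentially. v (u k) * w k < e \<and> v (u k - L) < e"
      by (rule eventually_conj)
    then obtain M where M: "v (u k) * w k < e" "v (u k - L) < e" if "k \<ge> M" for k
      by (auto simp: eventually_sequentially)
    show "\<exists>d>0. \<forall>h. v (of_nat h) < d \<longrightarrow> v (Q ^ h - 1 - L * of_nat h) \<le> e * v (of_nat h)"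
    \<comment> \<open>For nonzero \<open>h\<close> this radius forces the exact power p^k dividing
      \<open>h\<close> to have k >= M, where both estimates in \<open>M\<close> hold.\<close>
    proof (intro exI [of _ "1 / real p ^ M"] conjI allI impI)
      fix h assume h: "v (of_nat h) < 1 / real p ^ M"
      show "v (Q ^ h - 1 - L * of_nat h) \<le> e * v (of_nat h)"
      proof (cases "h = 0")
        case False
        define k where "k = multiplicity p h"
        obtain m where m: "h = p ^ k * m" "\<not> p dvd m"
          using multiplicity_decompose' [of h p] False p_gt_1 unfolding k_def by auto
        have "v (of_int (int m)) = 1"
          using m by (intro v_of_int_eq_1) simp
        then have vh: "v (of_nat h) = v (of_nat (p ^ k))"
          by (simp add: m mult)
        then have "1 / real p ^ k < 1 / real p ^ M"
          using h by (simp only: v_p_power)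
        then have "real p ^ M < real p ^ k"
          using p0 by (simp add: divide_simps)
        then have "M \<le> k"
          using p_gt_1 by simp
        have Qh: "Q ^ h = (Q ^ p ^ k) ^ m"
          unfolding m(1) by (rule power_mult)
        \<comment> \<open>As \<open>m * (Q ^ p ^ k - 1) = u k * h\<close>, the error splits into a
          quadratic one and the distance of the quotient \<open>u k\<close> from
          \<open>L\<close>.\<close>
        have "Q ^ h - 1 - L * of_nat h =
            ((Q ^ p ^ k) ^ m - 1 - of_nat m * (Q ^ p ^ k - 1)) + (u k - L) * of_nat h"
          unfolding Qh Qu by (simp add: m algebra_simps)
        also have "v \<dots> \<le> e * v (of_nat h)"
        proof (rule v_add_le)
          have "v (u k) * w k * v (of_nat (p ^ k)) \<le> e * v (of_nat (p ^ k))"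
            using M(1) [OF \<open>M \<le> k\<close>] by (intro mult_right_mono) (auto simp: nonneg)
          then show "v ((Q ^ p ^ k) ^ m - 1 - of_nat m * (Q ^ p ^ k - 1)) \<le> e * v (of_nat h)"
            using lin [of k m] unfolding vh by linarith
          show "v ((u k - L) * of_nat h) \<le> e * v (of_nat h)"
            using M(2) [OF \<open>M \<le> k\<close>] by (simp add: mult mult_right_mono nonneg)
        qed
        finally show ?thesis .
      qed simp
    qed (use p0 in simp)
  qed
qed

section \<open>The p-adic integers as the closure of the natural numbers\<close>

lemma Qp_iff: "x \<in> Qp v \<longleftrightarrow> (\<forall>e>0. \<exists>r. v (x - of_rat r) < e)"
  by (auto simp: Qp_def Metric_space.metric_closure_of [OF Metric_space_vdist]
      Metric_space.in_mball [OF Metric_space_vdist])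

text \<open>In lowest terms the denominator \<open>b\<close> is prime to \<open>p\<close>, so it has
  an inverse \<open>c\<close> modulo p^k; the residue of \<open>a * c\<close> then lies within p^-k
  of \<open>a / b\<close>.\<close>

lemma rat_approx_nat:
  assumes r: "v (of_rat r) \<le> 1" and e: "e > 0"
  obtains m where "v (of_nat m - of_rat r) < e"
proof -
  obtain a b where ab: "quotient_of r = (a, b)"
    by fastforce
  have b: "b > 0" and cop: "coprime a b" and req: "of_rat r = (of_int a / of_int b :: 'a)"
    using quotient_of_denom_pos [OF ab] quotient_of_coprime [OF ab] quotient_of_div [OF ab]
    by (simp_all add: of_rat_divide)
  have p: "Factorial_Ring.prime (int p)"
    using prime_p by simp
  have ndvd: "\<not> int p dvd b"
  proof
    assume dvd: "int p dvd b"
    then obtain c where c: "b = int p * c" ..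
    have "\<not> int p dvd a"
      using coprime_common_divisor [OF cop _ dvd] not_prime_unit p by blast
    then have "v (of_int a) = 1"
      by (rule v_of_int_eq_1)
    then have "1 \<le> v (of_int b)"
      using r v_pos [of "of_int b"] b by (simp add: req v_divide divide_simps)
    also have "v (of_int b) = v (of_int c) / p"
      using v_p_power [of 1] by (simp add: c mult)
    also have "\<dots> \<le> 1 / p"
      using v_of_int_le_1 [of c] by (intro divide_right_mono) auto
    also have "\<dots> < 1"
      using p_gt_1 by simp
    finally show False by simp
  qed
  obtain k where k: "v (of_nat (p ^ k)) < e"
    using order_tendstoD(2) [OF v_p_power_null e] by (auto simp: eventually_sequentially)
  have "coprime b (int p ^ k)"
    using prime_imp_coprime [OF p ndvd] by (simp add: coprime_commute)
  then obtain c where "[b * c = 1] (mod int p ^ k)"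
    using cong_solve_coprime_int by blast
  then have "[a * (b * c) = a * 1] (mod int p ^ k)"
    by (rule cong_scalar_left)
  define m where "m = nat ((a * c) mod int p ^ k)"
  have m: "int m = (a * c) mod int p ^ k"
    using p_gt_1 by (simp add: m_def)
  have "[int m * b = a * c * b] (mod int p ^ k)"
    unfolding m by (simp add: cong_def mod_mult_left_eq)
  also have "a * c * b = a * (b * c)" by simp
  also have "[a * (b * c) = a * 1] (mod int p ^ k)" by fact
  finally have "int p ^ k dvd int m * b - a"
    by (simp add: cong_iff_dvd_diff)
  then obtain t where t: "int m * b - a = int p ^ k * t" ..
  have "of_nat m - of_rat r = (of_int (int m * b - a) / of_int b :: 'a)"
    using b by (simp add: req field_simps)
  also have "v \<dots> = v (of_nat (p ^ k)) * v (of_int t)"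
    unfolding t by (simp add: v_divide v_of_int_eq_1 [OF ndvd] mult)
  also have "\<dots> < e"
    using k v_of_int_le_1 [of t] mult_left_le [OF v_of_int_le_1 nonneg, of "of_nat (p ^ k)" t] by linarith
  finally show thesis
    by (rule that)
qed

text \<open>Reduces claims about Z_p to natural numbers and a passage to the limit. A rational
  within distance 1 of a point of Z_p lies in the unit ball itself, so \<open>rat_approx_nat\<close>
  can replace it by a natural number.\<close>

lemma Zp_iff_vlim_of_nat: "x \<in> Zp v \<longleftrightarrow> (\<exists>s. vlim (\<lambda>k. of_nat (s k)) x)"
proof
  assume x: "x \<in> Zp v"
  have "\<exists>m. v (of_nat m - x) < 1 / real (Suc k)" for k
  proof -
    obtain r where r: "v (x - of_rat r) < 1 / real (Suc k)"
      using x [unfolded Zp_def mem_Collect_eq Qp_iff, THEN conjunct1, rule_format, of "1 / real (Suc k)"]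
      by auto
    have "1 / real (Suc k) \<le> 1" by simp
    with r have "v (x - of_rat r) \<le> 1" by linarith
    then have "v (of_rat r) \<le> 1"
      using v_diff_le [of x 1 "x - of_rat r"] x by (simp add: Zp_def)
    then obtain m where m: "v (of_nat m - of_rat r) < 1 / real (Suc k)"
      using rat_approx_nat [of r "1 / real (Suc k)"] by auto
    have "v ((of_nat m - of_rat r) - (x - of_rat r)) < 1 / real (Suc k)"
      using m r by (rule v_diff_less)
    then show ?thesis by auto
  qed
  then obtain s where s: "\<And>k. v (of_nat (s k) - x) < 1 / real (Suc k)"
    by metis
  have "vlim (\<lambda>k. of_nat (s k)) x"
    using s LIMSEQ_Suc [OF lim_1_over_n] by (intro vlim_squeeze) (auto intro: less_imp_le)
  then show "\<exists>s. vlim (\<lambda>k. of_nat (s k)) x"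
    by (rule exI [where x = s])
next
  assume "\<exists>s. vlim (\<lambda>k. of_nat (s k)) x"
  then obtain s where s: "vlim (\<lambda>k. of_nat (s k)) x"
    by blast
  have "\<exists>r. v (x - of_rat r) < e" if e: "e > 0" for e
  proof -
    obtain k where "v (of_nat (s k) - x) < e"
      using s e unfolding vlim_iff by blast
    then show ?thesis
      by (intro exI [of _ "of_nat (s k)"]) (simp add: v_minus_commute)
  qed
  moreover have "v x \<le> 1"
    using vlim_v [OF s] by (rule LIMSEQ_le_const2) (auto simp: v_of_nat_le_1)
  ultimately show "x \<in> Zp v"
    by (simp add: Zp_def Qp_iff)
qed

lemma of_nat_in_Zp [simp]: "of_nat k \<in> Zp v"
  unfolding Zp_iff_vlim_of_nat using vlim_const by (intro exI [of _ "\<lambda>_. k"]) simp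

lemma zero_in_Zp [simp]: "0 \<in> Zp v" and one_in_Zp [simp]: "1 \<in> Zp v"
  using of_nat_in_Zp [of 0] of_nat_in_Zp [of 1] by simp_all

lemma vlim_p_power: "vlim (\<lambda>k. of_nat (p ^ k)) 0"
  using v_p_power_null by (simp add: vlim_def)

text \<open>In Z_p, -1 is the limit of \<open>p ^ k - 1\<close>, which supplies natural numbers
  approximating \<open>1 - x\<close>.\<close>

lemma one_minus_in_Zp:
  assumes "x \<in> Zp v"
  shows "1 - x \<in> Zp v"
proof -
  obtain s where s: "vlim (\<lambda>k. of_nat (s k)) x"
    using assms by (auto simp: Zp_iff_vlim_of_nat)
  have "vlim (\<lambda>k. of_nat (1 + (p ^ k - 1) * s k)) (1 + (0 - 1) * x)"
    using vlim_add [OF vlim_const [of 1] vlim_mult [OF vlim_diff [OF vlim_p_power vlim_const [of 1]] s]] p_gt_1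
    by (simp add: of_nat_diff)
  then have "\<exists>t. vlim (\<lambda>k. of_nat (t k)) (1 + (0 - 1) * x)"
    by (rule exI [where x = "\<lambda>k. 1 + (p ^ k - 1) * s k"])
  then show ?thesis
    by (simp add: Zp_iff_vlim_of_nat)
qed

section \<open>Difference estimates for natural exponents\<close>

lemma v_power_diff_eq:
  assumes "v Q = 1"
  shows "v (Q ^ a - Q ^ b) = v (Q ^ (max a b - min a b) - 1)"
proof (cases "a \<le> b")
  case True
  then have "Q ^ b - Q ^ a = Q ^ a * (Q ^ (b - a) - 1)"
    by (simp add: algebra_simps flip: power_add)
  then show ?thesis
    using True assms by (subst v_minus_commute) (simp add: mult v_power)
next
  case False
  then have "Q ^ a - Q ^ b = Q ^ b * (Q ^ (a - b) - 1)"
    by (simp add: algebra_simps flip: power_add)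
  then show ?thesis
    using False assms by (simp add: mult v_power)
qed

lemma v_of_nat_diff_eq: "v (of_nat a - of_nat b) = v (of_nat (max a b - min a b))"
  by (cases "a \<le> b") (simp_all add: of_nat_diff v_minus_commute max_def)

text \<open>Factoring out the smaller power reduces the claim to \<open>Q ^ h - 1\<close>. For small
  |h| the derivative estimate applies; otherwise |Q^h - 1| <= 1 <= |h| / d.\<close>

lemma power_lipschitz:
  assumes Q: "v (1 - Q) < 1"
  obtains C where "0 \<le> C" "\<And>a b. v (Q ^ a - Q ^ b) \<le> C * v (of_nat a - of_nat b)"
proof -
  obtain L where L: "\<And>e. e > 0 \<Longrightarrow> \<exists>d>0. \<forall>h. v (of_nat h) < d \<longrightarrow>
    v (Q ^ h - 1 - L * of_nat h) \<le> e * v (of_nat h)"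
    using power_derivative_at_0 [OF Q] by blast
  obtain d where d: "d > 0" "\<And>h. v (of_nat h) < d \<Longrightarrow> v (Q ^ h - 1 - L * of_nat h) \<le> 1 * v (of_nat h)"
    using L [of 1] by auto
  \<comment> \<open>In order, the entries serve the case |h| >= d, the error term for e = 1, and the
    linear term \<open>L * of_nat h\<close>.\<close>
  define C where "C = max (1 / d) (max 1 (v L))"
  have "v (Q ^ h - 1) \<le> C * v (of_nat h)" for h
  proof (cases "v (of_nat h) < d")
    case True
    have "1 * v (of_nat h) \<le> C * v (of_nat h)" "v L * v (of_nat h) \<le> C * v (of_nat h)"
      by (intro mult_right_mono; simp add: C_def nonneg)+
    then have "v (Q ^ h - 1 - L * of_nat h + L * of_nat h) \<le> C * v (of_nat h)"
      using d(2) [OF True] by (intro v_add_le) (auto simp: mult)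
    then show ?thesis by simp
  next
    case False
    have "v (Q ^ h - 1) \<le> 1"
      using v_eq_1 [OF Q] by (intro v_diff_le) (auto simp: v_power)
    also have "1 = 1 / d * d" using d by simp
    also have "\<dots> \<le> C * v (of_nat h)"
      using False d by (intro mult_mono) (auto simp: C_def)
    finally show ?thesis .
  qed
  then have "v (Q ^ a - Q ^ b) \<le> C * v (of_nat a - of_nat b)" for a b
    unfolding v_power_diff_eq [OF v_eq_1 [OF Q]] v_of_nat_diff_eq .
  moreover have "0 \<le> C"
    by (simp add: C_def max.coboundedI2)
  ultimately show thesis
    by (rule that [rotated])
qed

text \<open>The estimate at 0 is multiplied by a power of \<open>Q\<close>. If b < a, it is
  \<open>Q ^ b\<close> that factors out, and replacing the slope \<open>L * Q ^ b\<close> by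
  \<open>L * Q ^ a\<close> costs a term controlled by the Lipschitz bound.\<close>

lemma power_uniformly_differentiable:
  assumes Q: "v (1 - Q) < 1"
  obtains L where "\<And>e. e > 0 \<Longrightarrow> \<exists>d>0. \<forall>a b. v (of_nat a - of_nat b) < d \<longrightarrow>
    v (Q ^ a - Q ^ b - L * Q ^ a * (of_nat a - of_nat b)) \<le> e * v (of_nat a - of_nat b)"
proof -
  obtain L where L: "\<And>e. e > 0 \<Longrightarrow> \<exists>d>0. \<forall>h. v (of_nat h) < d \<longrightarrow>
    v (Q ^ h - 1 - L * of_nat h) \<le> e * v (of_nat h)"
    using power_derivative_at_0 [OF Q] by blast
  obtain C where C: "0 \<le> C" "\<And>a b. v (Q ^ a - Q ^ b) \<le> C * v (of_nat a - of_nat b)"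
    using power_lipschitz [OF Q] by blast
  note vQ = v_eq_1 [OF Q]
  show thesis
  proof (rule that [of L])
    fix e :: real assume e: "e > 0"
    obtain d where d: "d > 0" "\<And>h. v (of_nat h) < d \<Longrightarrow> v (Q ^ h - 1 - L * of_nat h) \<le> e * v (of_nat h)"
      using L [OF e] by auto
    \<comment> \<open>The second entry keeps the slope correction below e |h|; adding 1 keeps its
      denominator positive.\<close>
    define d' where "d' = min d (e / (v L * C + 1))"
    have LC: "v L * C \<ge> 0" using C nonneg by simp
    show "\<exists>d>0. \<forall>a b. v (of_nat a - of_nat b) < d \<longrightarrow>
      v (Q ^ a - Q ^ b - L * Q ^ a * (of_nat a - of_nat b)) \<le> e * v (of_nat a - of_nat b)"
    proof (intro exI [of _ d'] conjI allI impI)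
      show "d' > 0"
        using d e LC by (simp add: d'_def add_nonneg_pos)
      fix a b :: nat assume ab: "v (of_nat a - of_nat b) < d'"
      show "v (Q ^ a - Q ^ b - L * Q ^ a * (of_nat a - of_nat b)) \<le> e * v (of_nat a - of_nat b)"
      proof (cases "a \<le> b")
        case True
        then obtain h where b: "b = a + h" using le_Suc_ex by blast
        have "v (of_nat h) < d" using ab by (simp add: b d'_def)
        have "Q ^ a - Q ^ b - L * Q ^ a * (of_nat a - of_nat b) = - (Q ^ a * (Q ^ h - 1 - L * of_nat h))"
          by (simp add: b power_add algebra_simps)
        also have "v \<dots> = v (Q ^ h - 1 - L * of_nat h)"
          by (simp only: v_minus mult v_power vQ) simp
        finally show ?thesis
          using d(2) [OF \<open>v (of_nat h) < d\<close>] by (simp add: b)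
      next
        case False
        then obtain h where a: "a = b + h" by (metis le_Suc_ex nat_le_linear)
        have h: "v (of_nat h) < d" "v (of_nat h) < e / (v L * C + 1)" using ab by (simp_all add: a d'_def)
        have "Q ^ a - Q ^ b - L * Q ^ a * (of_nat a - of_nat b) =
            Q ^ b * (Q ^ h - 1 - L * of_nat h) - L * (Q ^ a - Q ^ b) * of_nat h"
          by (simp add: a power_add algebra_simps)
        also have "v \<dots> \<le> e * v (of_nat h)"
        proof (rule v_diff_le)
          show "v (Q ^ b * (Q ^ h - 1 - L * of_nat h)) \<le> e * v (of_nat h)"
            using d(2) [OF h(1)] by (simp add: mult v_power vQ)
          have "v L * v (Q ^ a - Q ^ b) \<le> v L * (C * v (of_nat h))"
            using C(2) [of a b] by (intro mult_left_mono) (auto simp: a nonneg)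
          also have "\<dots> \<le> (v L * C + 1) * v (of_nat h)"
            using nonneg [of "of_nat h"] by (simp add: algebra_simps)
          also have "\<dots> \<le> e"
            using h(2) LC by (simp add: field_simps)
          finally show "v (L * (Q ^ a - Q ^ b) * of_nat h) \<le> e * v (of_nat h)"
            by (simp add: mult mult_right_mono nonneg)
        qed
        finally show ?thesis by (simp add: a)
      qed
    qed
  qed
qed

text \<open>By the Lipschitz bound, powers along two sequences with the same limit differ by a null
  sequence. Comparing \<open>s\<close> with its shift gives convergence, comparing it with other
  sequences gives independence of the choice; this justifies the \<open>THE\<close>.\<close>

lemma vlim_zp_power:
  assumes Q: "v (1 - Q) < 1" and s: "vlim (\<lambda>k. of_nat (s k)) x"
  shows "vlim (\<lambda>k. Q ^ s k) (zp_power v Q x)"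
proof -
  obtain C where C: "0 \<le> C" "\<And>a b. v (Q ^ a - Q ^ b) \<le> C * v (of_nat a - of_nat b)"
    using power_lipschitz [OF Q] by blast
  have null: "(\<lambda>k. v (Q ^ s' k - Q ^ s'' k)) \<longlonglongrightarrow> 0"
    if "vlim (\<lambda>k. of_nat (s' k)) x" "vlim (\<lambda>k. of_nat (s'' k)) x" for s' s''
  proof (rule Lim_null_comparison)
    show "\<forall>\<^sub>F k in sequentially. norm (v (Q ^ s' k - Q ^ s'' k)) \<le> C * v (of_nat (s' k) - of_nat (s'' k))"
      using C(2) by (simp add: nonneg)
    have "(\<lambda>k. v (of_nat (s' k) - of_nat (s'' k))) \<longlonglongrightarrow> 0"
      using vlim_diff [OF that] by (simp add: vlim_def)
    then show "(\<lambda>k. C * v (of_nat (s' k) - of_nat (s'' k))) \<longlonglongrightarrow> 0"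
      by (rule tendsto_mult_right_zero)
  qed
  have "vlim (\<lambda>k. of_nat (s (Suc k))) x"
    using s unfolding vlim_def by (rule LIMSEQ_Suc)
  then obtain L where L: "vlim (\<lambda>k. Q ^ s k) L"
    using convergent_if_diff_null [OF complete null [OF _ s]] by blast
  have all: "vlim (\<lambda>k. Q ^ t k) L" if "vlim (\<lambda>k. of_nat (t k)) x" for t
    using vlim_add [OF L, of "\<lambda>k. Q ^ t k - Q ^ s k" 0] null [OF that s] by (simp add: vlim_def)
  have "zp_power v Q x = L"
    unfolding zp_power_def limitin_vtopology_iff
  proof (rule the_equality)
    \<comment> \<open>The sequence \<open>s\<close> forces uniqueness: were no natural numbers
      tending to \<open>x\<close>, the defining condition would be vacuous.\<close>
    show "L' = L" if "\<forall>t. vlim (\<lambda>k. of_nat (t k)) x \<longrightarrow> vlim (\<lambda>k. Q ^ t k) L'" for L'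
      using that s L vlim_unique by blast
  qed (simp add: all)
  then show ?thesis
    using L by simp
qed

lemma zp_power_0:
  assumes "v (1 - Q) < 1"
  shows "zp_power v Q 0 = 1"
proof (rule vlim_unique)
  show "vlim (\<lambda>k. Q ^ 0) (zp_power v Q 0)"
    by (rule vlim_zp_power [OF assms]) simp
qed simp

lemma zp_power_add_1:
  assumes Q: "v (1 - Q) < 1" and x: "x \<in> Zp v"
  shows "zp_power v Q (x + 1) = Q * zp_power v Q x"
proof -
  obtain s where s: "vlim (\<lambda>k. of_nat (s k)) x"
    using x by (auto simp: Zp_iff_vlim_of_nat)
  have "vlim (\<lambda>k. of_nat (Suc (s k))) (x + 1)"
    using vlim_add [OF s vlim_const [of 1]] by (simp add: add.commute)
  then have "vlim (\<lambda>k. Q ^ Suc (s k)) (zp_power v Q (x + 1))"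
    by (rule vlim_zp_power [OF Q])
  moreover have "vlim (\<lambda>k. Q ^ Suc (s k)) (Q * zp_power v Q x)"
    using vlim_cmult [OF vlim_zp_power [OF Q s]] by simp
  ultimately show ?thesis
    by (rule vlim_unique)
qed

section \<open>Uniform differentiability\<close>

text \<open>Boundedness is part of the definition so that products can be treated directly; it avoids
  a compactness argument on \<open>\<int>\<^sub>p\<close>.\<close>
definition udiff :: "('a \<Rightarrow> 'a) \<Rightarrow> ('a \<Rightarrow> 'a) \<Rightarrow> bool" where
  "udiff f f' \<longleftrightarrow> (\<exists>C. \<forall>x\<in>Zp v. v (f x) \<le> C \<and> v (f' x) \<le> C) \<and>
     (\<forall>e>0. \<exists>d>0. \<forall>x\<in>Zp v. \<forall>y\<in>Zp v. v (x - y) < d \<longrightarrow>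
        v (f x - f y - f' x * (x - y)) \<le> e * v (x - y))"

lemma udiff_boundE:
  assumes "udiff f f'"
  obtains C where "0 \<le> C" "\<And>x. x \<in> Zp v \<Longrightarrow> v (f x) \<le> C" "\<And>x. x \<in> Zp v \<Longrightarrow> v (f' x) \<le> C"
proof -
  obtain C where C: "\<forall>x\<in>Zp v. v (f x) \<le> C \<and> v (f' x) \<le> C"
    using assms by (auto simp: udiff_def)
  moreover have "0 \<le> C"
    using C nonneg [of "f 0"] zero_in_Zp by (meson order_trans)
  ultimately show thesis
    using that by blast
qed

lemma udiffE:
  assumes "udiff f f'" "e > 0"
  obtains d where "0 < d" "\<And>x y. x \<in> Zp v \<Longrightarrow> y \<in> Zp v \<Longrightarrow> v (x - y) < d \<Longrightarrow>
    v (f x - f y - f' x * (x - y)) \<le> e * v (x - y)"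
  using assms unfolding udiff_def by meson

lemma udiff_imp_uniformly_differentiable_Zp:
  assumes "udiff f f'"
  shows "uniformly_differentiable_Zp v f"
  unfolding uniformly_differentiable_Zp_def
proof (intro exI [of _ f'] allI impI)
  fix e :: real assume "e > 0"
  \<comment> \<open>Halving turns the non-strict bound of \<open>udiff\<close> into the strict one
    required.\<close>
  then obtain d where d: "0 < d" "\<And>x y. x \<in> Zp v \<Longrightarrow> y \<in> Zp v \<Longrightarrow> v (x - y) < d \<Longrightarrow>
    v (f x - f y - f' x * (x - y)) \<le> e / 2 * v (x - y)"
    using udiffE [OF assms, of "e / 2"] by (metis half_gt_zero)
  show "\<exists>d>0. \<forall>x\<in>Zp v. \<forall>y\<in>Zp v. x \<noteq> y \<and> v (x - y) < d \<longrightarrow> v ((f x - f y) / (x - y) - f' x) < e"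
  proof (intro exI [of _ d] conjI ballI impI, fact)
    fix x y assume xy: "x \<in> Zp v" "y \<in> Zp v" "x \<noteq> y \<and> v (x - y) < d"
    then have "(f x - f y) / (x - y) - f' x = (f x - f y - f' x * (x - y)) / (x - y)"
      by (simp add: field_simps)
    then have "v ((f x - f y) / (x - y) - f' x) = v (f x - f y - f' x * (x - y)) / v (x - y)"
      by (simp only: v_divide)
    also have "\<dots> \<le> e / 2"
      using d(2) [of x y] xy v_pos [of "x - y"] by (simp add: divide_le_eq)
    also have "\<dots> < e"
      using \<open>e > 0\<close> by simp
    finally show "v ((f x - f y) / (x - y) - f' x) < e" .
  qed
qed

text \<open>Gives continuity on Z_p and controls the cross term of the product rule. The bound on
  the derivative built into \<open>udiff\<close> makes the constant uniform.\<close>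

lemma udiff_locally_lipschitz:
  assumes "udiff f f'"
  obtains d C where "0 < d" "0 < C" "\<And>x y. x \<in> Zp v \<Longrightarrow> y \<in> Zp v \<Longrightarrow> v (x - y) < d \<Longrightarrow>
    v (f x - f y) \<le> C * v (x - y)"
proof -
  obtain d where d: "0 < d" "\<And>x y. x \<in> Zp v \<Longrightarrow> y \<in> Zp v \<Longrightarrow> v (x - y) < d \<Longrightarrow>
    v (f x - f y - f' x * (x - y)) \<le> 1 * v (x - y)"
    using udiffE [OF assms, of 1] by (metis zero_less_one)
  obtain C where C: "0 \<le> C" "\<And>x. x \<in> Zp v \<Longrightarrow> v (f' x) \<le> C"
    using udiff_boundE [OF assms] by metis
  show thesis
  proof (rule that [of d "max 1 C"])
    fix x y assume xy: "x \<in> Zp v" "y \<in> Zp v" "v (x - y) < d"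
    have "v (f x - f y - f' x * (x - y) + f' x * (x - y)) \<le> max 1 C * v (x - y)"
    proof (rule v_add_le)
      show "v (f x - f y - f' x * (x - y)) \<le> max 1 C * v (x - y)"
        using d(2) [OF xy] mult_right_mono [of 1 "max 1 C" "v (x - y)"] nonneg by fastforce
      show "v (f' x * (x - y)) \<le> max 1 C * v (x - y)"
        using C(2) [OF xy(1)] by (simp add: mult mult_right_mono nonneg le_max_iff_disj)
    qed
    then show "v (f x - f y) \<le> max 1 C * v (x - y)"
      by simp
  qed (use d in auto)
qed

lemma udiff_vlim:
  assumes f: "udiff f f'" and s: "vlim s x" "\<And>k. s k \<in> Zp v" "x \<in> Zp v"
  shows "vlim (\<lambda>k. f (s k)) (f x)"
proof -
  obtain d C where d: "0 < d" and C: "0 < C" "\<And>x y. x \<in> Zp v \<Longrightarrow> y \<in> Zp v \<Longrightarrow> v (x - y) < d \<Longrightarrow>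
    v (f x - f y) \<le> C * v (x - y)"
    using udiff_locally_lipschitz [OF f] by metis
  have "\<forall>\<^sub>F k in sequentially. v (s k - x) < d"
    using s(1) d unfolding vlim_def by (rule order_tendstoD(2))
  then have "\<forall>\<^sub>F k in sequentially. norm (v (f (s k) - f x)) \<le> C * v (s k - x)"
    by eventually_elim (use C s in \<open>simp add: nonneg\<close>)
  moreover have "(\<lambda>k. C * v (s k - x)) \<longlonglongrightarrow> 0"
    using s(1) unfolding vlim_def by (rule tendsto_mult_right_zero)
  ultimately show ?thesis
    unfolding vlim_def by (rule Lim_null_comparison)
qed

section \<open>Rules for uniformly differentiable functions\<close>

lemma udiff_const: "udiff (\<lambda>_. c) (\<lambda>_. 0)"
  by (auto simp: udiff_def nonneg intro: exI [of _ "v c"] exI [of _ 1])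

lemma udiff_id: "udiff (\<lambda>x. x) (\<lambda>_. 1)"
  by (auto simp: udiff_def nonneg Zp_def intro: exI [of _ 1])

lemma udiff_affine:
  assumes f: "udiff f f'"
  shows "udiff (\<lambda>x. a + b * f x) (\<lambda>x. b * f' x)"
  unfolding udiff_def
proof (intro conjI allI impI)
  obtain C where C: "\<And>x. x \<in> Zp v \<Longrightarrow> v (f x) \<le> C" "\<And>x. x \<in> Zp v \<Longrightarrow> v (f' x) \<le> C"
    using udiff_boundE [OF f] by metis
  show "\<exists>C. \<forall>x\<in>Zp v. v (a + b * f x) \<le> C \<and> v (b * f' x) \<le> C"
    by (intro exI [of _ "max (v a) (v b * C)"] ballI conjI v_add_le)
      (auto simp: mult le_max_iff_disj mult_left_mono nonneg C)
  fix e :: real assume e: "e > 0"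
  have b: "v b + 1 > 0"
    using nonneg [of b] by linarith
  \<comment> \<open>Adding 1 to the denominator covers b = 0.\<close>
  obtain d where d: "0 < d" "\<And>x y. x \<in> Zp v \<Longrightarrow> y \<in> Zp v \<Longrightarrow> v (x - y) < d \<Longrightarrow>
    v (f x - f y - f' x * (x - y)) \<le> e / (v b + 1) * v (x - y)"
    using udiffE [OF f, of "e / (v b + 1)"] e b by (metis divide_pos_pos)
  show "\<exists>d>0. \<forall>x\<in>Zp v. \<forall>y\<in>Zp v. v (x - y) < d \<longrightarrow>
    v (a + b * f x - (a + b * f y) - b * f' x * (x - y)) \<le> e * v (x - y)"
  proof (intro exI [of _ d] conjI ballI impI, fact)
    fix x y assume xy: "x \<in> Zp v" "y \<in> Zp v" "v (x - y) < d"
    have "a + b * f x - (a + b * f y) - b * f' x * (x - y) = b * (f x - f y - f' x * (x - y))"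
      by (simp add: algebra_simps)
    then have "v (a + b * f x - (a + b * f y) - b * f' x * (x - y)) \<le> v b * (e / (v b + 1) * v (x - y))"
      using mult_left_mono [OF d(2) [OF xy] nonneg [of b]] by (simp only: mult)
    also have "\<dots> \<le> (v b + 1) * (e / (v b + 1) * v (x - y))"
      using e b by (intro mult_right_mono) (auto simp: nonneg)
    also have "\<dots> = e * v (x - y)"
      using b by simp
    finally show "v (a + b * f x - (a + b * f y) - b * f' x * (x - y)) \<le> e * v (x - y)" .
  qed
qed

lemma udiff_reflect:
  assumes f: "udiff f f'"
  shows "udiff (\<lambda>x. f (1 - x)) (\<lambda>x. - f' (1 - x))"
  unfolding udiff_def
proof (intro conjI allI impI)
  obtain C where C: "\<And>x. x \<in> Zp v \<Longrightarrow> v (f x) \<le> C" "\<And>x. x \<in> Zp v \<Longrightarrow> v (f' x) \<le> C"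
    using udiff_boundE [OF f] by metis
  then show "\<exists>C. \<forall>x\<in>Zp v. v (f (1 - x)) \<le> C \<and> v (- f' (1 - x)) \<le> C"
    by (intro exI [of _ C]) (simp add: one_minus_in_Zp)
  fix e :: real assume "e > 0"
  then obtain d where d: "0 < d" "\<And>x y. x \<in> Zp v \<Longrightarrow> y \<in> Zp v \<Longrightarrow> v (x - y) < d \<Longrightarrow>
    v (f x - f y - f' x * (x - y)) \<le> e * v (x - y)"
    using udiffE [OF f] by metis
  show "\<exists>d>0. \<forall>x\<in>Zp v. \<forall>y\<in>Zp v. v (x - y) < d \<longrightarrow>
    v (f (1 - x) - f (1 - y) - - f' (1 - x) * (x - y)) \<le> e * v (x - y)"
  proof (intro exI [of _ d] conjI ballI impI, fact)
    fix x y assume xy: "x \<in> Zp v" "y \<in> Zp v" "v (x - y) < d"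
    have "v ((1 - x) - (1 - y)) = v (x - y)"
      using v_minus_commute [of x y] by simp
    moreover have "- f' (1 - x) * (x - y) = f' (1 - x) * ((1 - x) - (1 - y))"
      by (simp add: algebra_simps)
    ultimately show "v (f (1 - x) - f (1 - y) - - f' (1 - x) * (x - y)) \<le> e * v (x - y)"
      using d(2) [of "1 - x" "1 - y"] xy one_minus_in_Zp by (simp only:)
  qed
qed

lemma udiff_mult:
  assumes f: "udiff f f'" and g: "udiff g g'"
  shows "udiff (\<lambda>x. f x * g x) (\<lambda>x. f' x * g x + f x * g' x)"
  unfolding udiff_def
proof (intro conjI allI impI)
  obtain C where C: "0 \<le> C" "\<And>x. x \<in> Zp v \<Longrightarrow> v (f x) \<le> C" "\<And>x. x \<in> Zp v \<Longrightarrow> v (f' x) \<le> C"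
    using udiff_boundE [OF f] by metis
  obtain D where D: "0 \<le> D" "\<And>x. x \<in> Zp v \<Longrightarrow> v (g x) \<le> D" "\<And>x. x \<in> Zp v \<Longrightarrow> v (g' x) \<le> D"
    using udiff_boundE [OF g] by metis
  show "\<exists>C. \<forall>x\<in>Zp v. v (f x * g x) \<le> C \<and> v (f' x * g x + f x * g' x) \<le> C"
    by (intro exI [of _ "C * D"] ballI conjI v_add_le) (auto simp: mult nonneg C D intro!: mult_mono)
  fix e :: real assume e: "e > 0"
  define B where "B = max C D + 1"
  have B: "B > 0" "C \<le> B" "D \<le> B"
    using C(1) by (auto simp: B_def)
  obtain d1 where d1: "0 < d1" "\<And>x y. x \<in> Zp v \<Longrightarrow> y \<in> Zp v \<Longrightarrow> v (x - y) < d1 \<Longrightarrow>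
    v (f x - f y - f' x * (x - y)) \<le> e / B * v (x - y)"
    using udiffE [OF f, of "e / B"] e B by (metis divide_pos_pos)
  obtain d2 where d2: "0 < d2" "\<And>x y. x \<in> Zp v \<Longrightarrow> y \<in> Zp v \<Longrightarrow> v (x - y) < d2 \<Longrightarrow>
    v (g x - g y - g' x * (x - y)) \<le> e / B * v (x - y)"
    using udiffE [OF g, of "e / B"] e B by (metis divide_pos_pos)
  obtain d3 K where d3: "0 < d3" "0 < K" "\<And>x y. x \<in> Zp v \<Longrightarrow> y \<in> Zp v \<Longrightarrow> v (x - y) < d3 \<Longrightarrow>
    v (f x - f y) \<le> K * v (x - y)"
    using udiff_locally_lipschitz [OF f] by metis
  \<comment> \<open>The last entry makes the cross factor \<open>(f x - f y) * g' x\<close> at most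
    \<open>e\<close> in absolute value.\<close>
  define d where "d = min (min d1 d2) (min d3 (e / (K * B)))"
  show "\<exists>d>0. \<forall>x\<in>Zp v. \<forall>y\<in>Zp v. v (x - y) < d \<longrightarrow>
    v (f x * g x - f y * g y - (f' x * g x + f x * g' x) * (x - y)) \<le> e * v (x - y)"
  proof (intro exI [of _ d] conjI ballI impI)
    show "0 < d"
      using d1 d2 d3 e B by (simp add: d_def)
    fix x y assume xy: "x \<in> Zp v" "y \<in> Zp v" "v (x - y) < d"
    then have *: "v (x - y) < d1" "v (x - y) < d2" "v (x - y) < d3" "v (x - y) \<le> e / (K * B)"
      by (simp_all add: d_def)
    \<comment> \<open>The increment of \<open>g\<close> carries the factor \<open>f y\<close> but
      its derivative carries \<open>f x\<close>; the last term corrects this mismatch and is of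
      second order.\<close>
    have "f x * g x - f y * g y - (f' x * g x + f x * g' x) * (x - y) =
      g x * (f x - f y - f' x * (x - y)) + f y * (g x - g y - g' x * (x - y))
        - (f x - f y) * g' x * (x - y)"
      by (simp add: algebra_simps)
    also have "v \<dots> \<le> e * v (x - y)"
    proof (intro v_diff_le v_add_le)
      have "v (g x) * v (f x - f y - f' x * (x - y)) \<le> B * (e / B * v (x - y))"
        using d1(2) [OF xy(1,2) *(1)] D(2) [OF xy(1)] B by (intro mult_mono) (auto simp: nonneg)
      then show "v (g x * (f x - f y - f' x * (x - y))) \<le> e * v (x - y)"
        using B by (simp add: mult)
      have "v (f y) * v (g x - g y - g' x * (x - y)) \<le> B * (e / B * v (x - y))"
        using d2(2) [OF xy(1,2) *(2)] C(2) [OF xy(2)] B by (intro mult_mono) (auto simp: nonneg)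
      then show "v (f y * (g x - g y - g' x * (x - y))) \<le> e * v (x - y)"
        using B by (simp add: mult)
      have "v (f x - f y) \<le> K * (e / (K * B))"
        using d3(3) [OF xy(1,2) *(3)] mult_left_mono [OF *(4), of K] d3(2) by linarith
      then have "v (f x - f y) * v (g' x) \<le> K * (e / (K * B)) * B"
        using D(3) [OF xy(1)] B d3(2) e by (intro mult_mono) (auto simp: nonneg)
      also have "\<dots> = e"
        using d3(2) B by simp
      finally show "v ((f x - f y) * g' x * (x - y)) \<le> e * v (x - y)"
        by (simp add: mult mult_right_mono nonneg)
    qed
    finally show "v (f x * g x - f y * g y - (f' x * g x + f x * g' x) * (x - y)) \<le> e * v (x - y)" .
  qed
qed

lemma udiff_power: "udiff f f' \<Longrightarrow> \<exists>g'. udiff (\<lambda>x. f x ^ n) g'"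
proof (induction n)
  case 0
  show ?case using udiff_const [of 1] by auto
next
  case (Suc n)
  then show ?case using udiff_mult by fastforce
qed

section \<open>Uniform differentiability of the power function and the bracket\<close>

lemma udiff_zp_power:
  assumes Q: "v (1 - Q) < 1"
  obtains L where "udiff (zp_power v Q) (\<lambda>x. L * zp_power v Q x)"
proof -
  obtain L where L: "\<And>e. e > 0 \<Longrightarrow> \<exists>d>0. \<forall>a b. v (of_nat a - of_nat b) < d \<longrightarrow>
    v (Q ^ a - Q ^ b - L * Q ^ a * (of_nat a - of_nat b)) \<le> e * v (of_nat a - of_nat b)"
    using power_uniformly_differentiable [OF Q] by blast
  have bound: "v (zp_power v Q x) \<le> 1" if x: "x \<in> Zp v" for x
  proof -
    obtain s where s: "vlim (\<lambda>k. of_nat (s k)) x"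
      using x by (auto simp: Zp_iff_vlim_of_nat)
    show ?thesis
      using vlim_v [OF vlim_zp_power [OF Q s]]
      by (rule LIMSEQ_le_const2) (simp add: v_power v_eq_1 [OF Q])
  qed
  have "udiff (zp_power v Q) (\<lambda>x. L * zp_power v Q x)"
    unfolding udiff_def
  proof (intro conjI allI impI)
    have "v L * v (zp_power v Q x) \<le> v L" if "x \<in> Zp v" for x
      using bound [OF that] by (simp add: mult_left_le nonneg)
    then show "\<exists>C. \<forall>x\<in>Zp v. v (zp_power v Q x) \<le> C \<and> v (L * zp_power v Q x) \<le> C"
      using bound by (intro exI [of _ "max 1 (v L)"]) (auto simp: mult le_max_iff_disj)
    fix e :: real assume "e > 0"
    then obtain d where d: "d > 0" "\<And>a b. v (of_nat a - of_nat b) < d \<Longrightarrow>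
        v (Q ^ a - Q ^ b - L * Q ^ a * (of_nat a - of_nat b)) \<le> e * v (of_nat a - of_nat b)"
      using L by metis
    show "\<exists>d>0. \<forall>x\<in>Zp v. \<forall>y\<in>Zp v. v (x - y) < d \<longrightarrow>
        v (zp_power v Q x - zp_power v Q y - L * zp_power v Q x * (x - y)) \<le> e * v (x - y)"
    proof (intro exI [of _ d] conjI ballI impI, fact)
      fix x y assume xy: "x \<in> Zp v" "y \<in> Zp v" "v (x - y) < d"
      obtain s where s: "vlim (\<lambda>k. of_nat (s k)) x"
        using xy by (auto simp: Zp_iff_vlim_of_nat)
      obtain t where t: "vlim (\<lambda>k. of_nat (t k)) y"
        using xy by (auto simp: Zp_iff_vlim_of_nat)
      note st = vlim_diff [OF s t]
      note s' = vlim_zp_power [OF Q s] and t' = vlim_zp_power [OF Q t]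
      \<comment> \<open>The distances tend to |x - y| < d, so the estimate for natural exponents
        eventually applies; being non-strict, it survives the limit.\<close>
      have "\<forall>\<^sub>F k in sequentially. v (of_nat (s k) - of_nat (t k)) < d"
        using vlim_v [OF st] xy(3) by (rule order_tendstoD(2))
      then have le: "\<forall>\<^sub>F k in sequentially.
          v (Q ^ s k - Q ^ t k - L * Q ^ s k * (of_nat (s k) - of_nat (t k)))
            \<le> e * v (of_nat (s k) - of_nat (t k))"
        by eventually_elim (rule d(2))
      show "v (zp_power v Q x - zp_power v Q y - L * zp_power v Q x * (x - y)) \<le> e * v (x - y)"
        using tendsto_mult_left [OF vlim_v [OF st], of e]
          vlim_v [OF vlim_diff [OF vlim_diff [OF s' t'] vlim_mult [OF vlim_cmult [OF s', of L] st]]] le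
        by (rule tendsto_le [OF sequentially_bot])
    qed
  qed
  then show thesis
    by (rule that)
qed

lemma udiff_q_bracket:
  assumes Q: "v (1 - Q) < 1"
  obtains f' where "udiff (q_bracket v Q) f'"
proof (cases "Q = 1")
  case True
  then have "q_bracket v Q = (\<lambda>x. x)"
    by (auto simp: q_bracket_def)
  then show thesis
    using udiff_id that by metis
next
  case False
  obtain L where L: "udiff (zp_power v Q) (\<lambda>x. L * zp_power v Q x)"
    using udiff_zp_power [OF Q] by blast
  have "q_bracket v Q = (\<lambda>x. 1 / (1 - Q) + - 1 / (1 - Q) * zp_power v Q x)"
    using False by (auto simp: q_bracket_def diff_divide_distrib)
  then show thesis
    using udiff_affine [OF L] that by metis
qed

section \<open>Moments of the fermionic integrals\<close>

lemma q_bracket_0: "v (1 - Q) < 1 \<Longrightarrow> q_bracket v Q 0 = 0"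
  by (simp add: q_bracket_def zp_power_0)

text \<open>Both branches of \<open>q_bracket\<close> obey this recurrence, so the moments can be
  computed without treating \<open>Q = 1\<close> separately.\<close>

lemma q_bracket_add_1:
  assumes "v (1 - Q) < 1" "x \<in> Zp v"
  shows "q_bracket v Q (x + 1) = 1 + Q * q_bracket v Q x"
  using assms by (simp add: q_bracket_def zp_power_add_1 divide_simps) (simp add: algebra_simps)

lemma q_bracket_1: "v (1 - Q) < 1 \<Longrightarrow> q_bracket v Q 1 = 1"
  using q_bracket_add_1 [of Q 0] by (simp add: q_bracket_0)

lemma q_bracket_2: "v (1 - Q) < 1 \<Longrightarrow> q_bracket v Q 2 = 1 + Q"
  using q_bracket_add_1 [of Q 1] by (simp add: q_bracket_1)

text \<open>Taking a function on the natural numbers gives shifted and reflected integrands the same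
  form. The normalising factor is restored in
  \<open>has_fermionic_integral_if_vlim_fsum\<close>.\<close>

definition fsum :: "'a \<Rightarrow> (nat \<Rightarrow> 'a) \<Rightarrow> nat \<Rightarrow> 'a" where
  "fsum Q f N = (\<Sum>x<p ^ N. f x * (- Q) ^ x)"

lemma vlim_power_p_power:
  assumes "v (1 - Q) < 1"
  shows "vlim (\<lambda>N. Q ^ p ^ N) 1"
  using power_p_power_null [OF assms] by (simp add: vlim_def)

lemma fsum_shift:
  assumes odd: "odd p" and Q: "v (1 - Q) < 1" and f: "vlim (\<lambda>N. f (p ^ N)) A"
  shows "vlim (\<lambda>N. Q * fsum Q (\<lambda>x. f (Suc x)) N + fsum Q f N) (f 0 + A)"
proof -
  have tele: "Q * (\<Sum>x<m. f (Suc x) * (- Q) ^ x) + (\<Sum>x<m. f x * (- Q) ^ x) = f 0 - f m * (- Q) ^ m" for m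
    by (induction m) (simp_all add: algebra_simps)
  \<comment> \<open>Oddness of \<open>p\<close> gives (-Q)^(p^N) = -Q^(p^N), which turns the
    boundary difference into a sum.\<close>
  have "Q * fsum Q (\<lambda>x. f (Suc x)) N + fsum Q f N = f 0 + f (p ^ N) * Q ^ p ^ N" for N
    using odd unfolding fsum_def tele by (simp add: power_minus_odd)
  then show ?thesis
    using vlim_add [OF vlim_const vlim_mult [OF f vlim_power_p_power [OF Q]], of "f 0"] by simp
qed

text \<open>As \<open>Q ^ p ^ N\<close> tends to 1, the normalising factor tends to (1 + Q) / 2, and
  it remains to find limits of unnormalised sums.\<close>

lemma has_fermionic_integral_if_vlim_fsum:
  assumes odd: "odd p" and Q: "v (1 - Q) < 1" and f: "udiff f f'"
    and J: "vlim (fsum Q (\<lambda>x. f (of_nat x))) J"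
  shows "has_fermionic_integral v p Q f ((1 + Q) / 2 * J)"
proof -
  have "vlim (\<lambda>N. (1 + Q) / (1 + Q ^ p ^ N)) ((1 + Q) / (1 + 1))"
    using one_plus_power_nonzero [OF odd Q]
    by (intro vlim_divide vlim_add vlim_const vlim_power_p_power [OF Q]) auto
  moreover have "1 / neg_bracket Q (p ^ N) = (1 + Q) / (1 + Q ^ p ^ N)" for N
    using odd by (simp add: neg_bracket_def power_minus_odd)
  ultimately have "vlim (\<lambda>N. 1 / neg_bracket Q (p ^ N)) ((1 + Q) / 2)"
    by simp
  from vlim_mult [OF this J] show ?thesis
    unfolding has_fermionic_integral_def limitin_vtopology_iff fsum_def
    using udiff_imp_uniformly_differentiable_Zp [OF f] by simp
qed

lemma fermionic_integral_eqI:
  assumes "has_fermionic_integral v p Q f I"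
  shows "fermionic_integral v p Q f = I"
  unfolding fermionic_integral_def
proof (rule the_equality)
  show "has_fermionic_integral v p Q f I"
    by fact
  fix I' assume "has_fermionic_integral v p Q f I'"
  with assms show "I' = I"
    unfolding has_fermionic_integral_def limitin_vtopology_iff by (blast intro: vlim_unique)
qed

text \<open>The total coefficient of \<open>S n\<close> in the hypothesis is \<open>1 + R\<^bsup>n+1\<^esup>\<close>, so the recurrence
  determines the limits inductively.\<close>
lemma vlim_if_vlim_euler_recurrence:
  assumes nz: "\<And>n. 1 + R ^ (n + 1) \<noteq> 0"
    and rec: "\<And>n. vlim (\<lambda>N. S n N + R * (\<Sum>l\<le>n. of_nat (n choose l) * R ^ l * S l N))
                  (Y n + R * (\<Sum>l\<le>n. of_nat (n choose l) * R ^ l * Y l))"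
  shows "vlim (S n) (Y n)"
proof (induction n rule: less_induct)
  case (less n)
  have "vlim (\<lambda>N. R * (\<Sum>l<n. of_nat (n choose l) * R ^ l * S l N))
      (R * (\<Sum>l<n. of_nat (n choose l) * R ^ l * Y l))"
    using less by (intro vlim_cmult vlim_sum) auto
  from vlim_cmult [OF vlim_diff [OF rec [of n] this], of "1 / (1 + R ^ (n + 1))"]
  have lim: "vlim
     (\<lambda>N. 1 / (1 + R ^ (n + 1)) * (S n N + R * (\<Sum>l\<le>n. of_nat (n choose l) * R ^ l * S l N)
        - R * (\<Sum>l<n. of_nat (n choose l) * R ^ l * S l N)))
     (1 / (1 + R ^ (n + 1)) * (Y n + R * (\<Sum>l\<le>n. of_nat (n choose l) * R ^ l * Y l)
        - R * (\<Sum>l<n. of_nat (n choose l) * R ^ l * Y l)))" .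
  \<comment> \<open>Stated for arbitrary \<open>z\<close> because it serves both the limits
    \<open>Y\<close> and, for each \<open>N\<close>, the sums \<open>S l N\<close>.\<close>
  have "1 / (1 + R ^ (n + 1)) * (z n + R * (\<Sum>l\<le>n. of_nat (n choose l) * R ^ l * z l)
        - R * (\<Sum>l<n. of_nat (n choose l) * R ^ l * z l)) = z n" for z :: "nat \<Rightarrow> 'a"
  proof -
    have "z n + R * (\<Sum>l\<le>n. of_nat (n choose l) * R ^ l * z l)
        - R * (\<Sum>l<n. of_nat (n choose l) * R ^ l * z l) = (1 + R ^ (n + 1)) * z n"
      by (simp add: lessThan_Suc_atMost [symmetric] algebra_simps)
    then show ?thesis
      using nz [of n] by simp
  qed
  from lim [unfolded this this [of "\<lambda>l. S l _"]] show ?case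
    by simp
qed

text \<open>The factor \<open>0 ^ n\<close>, equal to 1 at n = 0 and to 0 otherwise, merges the
  initial value into the implicit recurrence.\<close>

lemma q_euler_recurrence:
  assumes "\<And>n. 1 + R ^ (n + 1) \<noteq> (0 :: 'a)"
  shows "q_euler R n + R * (\<Sum>l\<le>n. of_nat (n choose l) * R ^ l * q_euler R l) = (1 + R) * 0 ^ n"
proof (cases "n = 0")
  case True
  then show ?thesis by (simp add: q_euler.simps [of R 0])
next
  case False
  then show ?thesis
    using q_euler_unique [OF assms, where \<xi> = "q_euler R"] by (simp add: atLeast0AtMost add.commute)
qed

lemma binomial_one_plus_mult:
  "(1 + R * y) ^ n = (\<Sum>l\<le>n. of_nat (n choose l) * R ^ l * (y :: 'a) ^ l)"
  using binomial_ring [of "R * y" 1 n] by (simp add: add.commute power_mult_distrib mult.assoc)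

lemma fsum_lincomb:
  "fsum Q (\<lambda>x. \<Sum>l\<in>A. c l * f l x) N = (\<Sum>l\<in>A. c l * fsum Q (f l) N)"
proof -
  have "fsum Q (\<lambda>x. \<Sum>l\<in>A. c l * f l x) N = (\<Sum>x<p ^ N. \<Sum>l\<in>A. c l * (f l x * (- Q) ^ x))"
    by (simp add: fsum_def sum_distrib_right mult.assoc)
  also have "\<dots> = (\<Sum>l\<in>A. c l * fsum Q (f l) N)"
    by (subst sum.swap) (simp add: fsum_def sum_distrib_left)
  finally show ?thesis .
qed

lemma vlim_fsum_q_bracket:
  assumes odd: "odd p" and R: "v (1 - R) < 1"
  shows "vlim (fsum R (\<lambda>x. q_bracket v R (of_nat x) ^ n)) (2 / (1 + R) * q_euler R n)"
proof -
  define b where "b x = q_bracket v R (of_nat x)" for x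
  note nz = one_plus_power_nonzero [OF odd R]
  have b: "b 0 = 0" "b (Suc x) = 1 + R * b x" for x
    using q_bracket_add_1 [OF R, of "of_nat x"] by (simp_all add: b_def q_bracket_0 [OF R] add.commute)
  obtain f' where f': "udiff (q_bracket v R) f'"
    using udiff_q_bracket [OF R] by blast
  have blim: "vlim (\<lambda>N. b (p ^ N) ^ n) (0 ^ n)" for n
    using udiff_vlim [OF f' vlim_p_power of_nat_in_Zp] by (intro vlim_power) (simp add: b_def q_bracket_0 [OF R])
  have "vlim (fsum R (\<lambda>x. b x ^ n)) (2 / (1 + R) * q_euler R n)"
  proof (rule vlim_if_vlim_euler_recurrence [where S = "\<lambda>n. fsum R (\<lambda>x. b x ^ n)"])
    show "1 + R ^ (n + 1) \<noteq> 0" for n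
      by (rule nz)
    fix n
    \<comment> \<open>The factor 2 / (1 + R) scales the right-hand side of the Euler recurrence to
      \<open>0 ^ n + 0 ^ n\<close>, the limit of the boundary terms.\<close>
    have "2 / (1 + R) * q_euler R n + R * (\<Sum>l\<le>n. of_nat (n choose l) * R ^ l * (2 / (1 + R) * q_euler R l))
        = 2 / (1 + R) * (q_euler R n + R * (\<Sum>l\<le>n. of_nat (n choose l) * R ^ l * q_euler R l))"
      by (simp add: sum_distrib_left distrib_left mult_ac)
    also have "\<dots> = 0 ^ n + 0 ^ n"
      using nz [of 1] by (subst q_euler_recurrence [OF nz]) simp
    finally have Y: "2 / (1 + R) * q_euler R n
        + R * (\<Sum>l\<le>n. of_nat (n choose l) * R ^ l * (2 / (1 + R) * q_euler R l)) = b 0 ^ n + 0 ^ n"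
      by (simp add: b)
    \<comment> \<open>Expanding \<open>b (Suc x) ^ n = (1 + R * b x) ^ n\<close> turns the shifted
      sum into the Euler combination.\<close>
    have X: "fsum R (\<lambda>x. b x ^ n) N + R * (\<Sum>l\<le>n. of_nat (n choose l) * R ^ l * fsum R (\<lambda>x. b x ^ l) N)
        = R * fsum R (\<lambda>x. b (Suc x) ^ n) N + fsum R (\<lambda>x. b x ^ n) N" for N
      by (simp add: b binomial_one_plus_mult fsum_lincomb)
    show "vlim (\<lambda>N. fsum R (\<lambda>x. b x ^ n) N
          + R * (\<Sum>l\<le>n. of_nat (n choose l) * R ^ l * fsum R (\<lambda>x. b x ^ l) N))
        (2 / (1 + R) * q_euler R n
          + R * (\<Sum>l\<le>n. of_nat (n choose l) * R ^ l * (2 / (1 + R) * q_euler R l)))"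
      unfolding X Y by (rule fsum_shift [OF odd R, where f = "\<lambda>x. b x ^ n", OF blim])
  qed
  then show ?thesis
    by (simp add: b_def)
qed

lemma v_one_minus_inverse:
  assumes "v (1 - q) < 1"
  shows "v (1 - 1 / q) < 1"
proof -
  have "q \<noteq> 0"
    using v_eq_1 [OF assms] by auto
  then have "1 - 1 / q = (q - 1) / q"
    by (simp add: field_simps)
  then show ?thesis
    using assms v_eq_1 [OF assms] by (simp add: v_divide v_minus_commute)
qed

text \<open>The term with \<open>0 ^ n\<close> adjusts the case n = 0, where the limit is 2 / (1 +
  q), belonging to the constant 1. The recurrence for larger \<open>n\<close> starts from that
  case.\<close>

lemma vlim_fsum_q_bracket_reflect:
  fixes q :: 'a
  assumes odd: "odd p" and q: "v (1 - q) < 1"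
  defines "R \<equiv> 1 / q"
  shows "vlim (fsum q (\<lambda>x. q_bracket v R (1 - of_nat x) ^ n))
    (2 / (1 + q) * (1 + q + q\<^sup>2 * q_euler R n - (q + q\<^sup>2) * 0 ^ n))"
proof -
  define g where "g x = q_bracket v R (1 - of_nat x)" for x
  have R: "v (1 - R) < 1"
    unfolding R_def by (rule v_one_minus_inverse [OF q])
  note nz = one_plus_power_nonzero [OF odd R]
  have q0: "q \<noteq> 0" "1 + q \<noteq> 0"
    using v_eq_1 [OF q] one_plus_power_nonzero [OF odd q, of 1] by auto
  \<comment> \<open>\<open>1 - x\<close> is the successor of \<open>1 - (x + 1)\<close>, so the
    recurrence runs backwards and powers of \<open>g x\<close> expand in powers of
    \<open>g (Suc x)\<close>.\<close>
  have g: "g 0 = 1" "g x = 1 + R * g (Suc x)" for x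
    using q_bracket_add_1 [OF R one_minus_in_Zp [OF of_nat_in_Zp [of "Suc x"]]]
    by (simp_all add: g_def q_bracket_1 [OF R])
  obtain f' where f': "udiff (q_bracket v R) f'"
    using udiff_q_bracket [OF R] by blast
  \<comment> \<open>Both boundary values, at 0 and in the limit along p^N, equal [1]_R = 1, so every
    telescoped sum \<open>T l\<close> below tends to 2.\<close>
  have glim: "vlim (\<lambda>N. g (p ^ N) ^ n) (1 ^ n)" for n
    using udiff_vlim [OF udiff_reflect [OF f'] vlim_p_power of_nat_in_Zp]
    by (intro vlim_power) (simp add: g_def q_bracket_1 [OF R])
  define Y where "Y n = 2 / (1 + q) * (1 + q + q\<^sup>2 * q_euler R n - (q + q\<^sup>2) * 0 ^ n)" for n
  have "vlim (fsum q (\<lambda>x. g x ^ n)) (Y n)"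
  proof (rule vlim_if_vlim_euler_recurrence [where S = "\<lambda>n. fsum q (\<lambda>x. g x ^ n)"])
    show "1 + R ^ (n + 1) \<noteq> 0" for n
      by (rule nz)
    fix n
    define T where "T l N = q * fsum q (\<lambda>x. g (Suc x) ^ l) N + fsum q (\<lambda>x. g x ^ l) N" for l N
    have T: "vlim (T l) (1 + 1)" for l
      using fsum_shift [OF odd q, where f = "\<lambda>x. g x ^ l", OF glim] by (simp add: T_def [abs_def] g(1))
    define c where "c l = of_nat (n choose l) * R ^ l" for l
    have "fsum q (\<lambda>x. g x ^ n) N = (\<Sum>l\<le>n. c l * fsum q (\<lambda>x. g (Suc x) ^ l) N)" for N
      unfolding c_def fsum_lincomb [symmetric] binomial_one_plus_mult [symmetric] g(2) [symmetric] ..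
    \<comment> \<open>Solving \<open>T\<close> for the shifted sum uses \<open>R * q = 1\<close>;
      substituting it produces the Euler combination with a convergent right-hand side.\<close>
    moreover have "fsum q (\<lambda>x. g (Suc x) ^ l) N = R * (T l N - fsum q (\<lambda>x. g x ^ l) N)" for l N
      using q0 by (simp add: T_def R_def)
    ultimately have X: "fsum q (\<lambda>x. g x ^ n) N + R * (\<Sum>l\<le>n. c l * fsum q (\<lambda>x. g x ^ l) N)
        = R * (\<Sum>l\<le>n. c l * T l N)" for N
      by (simp add: sum_distrib_left sum_subtractf algebra_simps)
    have c0: "(\<Sum>l\<le>n. c l * 0 ^ l) = 1"
      using binomial_one_plus_mult [of R 0 n] by (simp add: c_def)
    have E: "q_euler R n + R * (\<Sum>l\<le>n. c l * q_euler R l) = (1 + R) * 0 ^ n"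
      using q_euler_recurrence [OF nz] by (simp only: c_def)
    have "(\<Sum>l\<le>n. c l * Y l) = 2 / (1 + q) * ((1 + q) * (\<Sum>l\<le>n. c l)
        + q\<^sup>2 * (\<Sum>l\<le>n. c l * q_euler R l) - (q + q\<^sup>2) * (\<Sum>l\<le>n. c l * 0 ^ l))"
      unfolding Y_def sum_distrib_left sum_subtractf [symmetric] sum.distrib [symmetric]
      by (intro sum.cong refl) (simp only: ring_distribs mult_ac)
    \<comment> \<open>The Euler part contributes \<open>(q + q\<^sup>2) * 0 ^ n\<close>, which
      cancels the correction term, and \<open>R * (q + q\<^sup>2)\<close> cancels
      \<open>1 + q\<close>. Only twice \<open>R * (\<Sum>l\<le>n. c l)\<close> remains.\<close>
    then have "Y n + R * (\<Sum>l\<le>n. c l * Y l) = 2 / (1 + q) * (1 + q + R * (1 + q) * (\<Sum>l\<le>n. c l)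
        + q\<^sup>2 * (q_euler R n + R * (\<Sum>l\<le>n. c l * q_euler R l)) - (q + q\<^sup>2) * 0 ^ n - R * (q + q\<^sup>2))"
      unfolding c0 Y_def by (simp only: ring_distribs mult_ac mult_1_right) (simp add: algebra_simps)
    also have "q\<^sup>2 * (q_euler R n + R * (\<Sum>l\<le>n. c l * q_euler R l)) = (q + q\<^sup>2) * 0 ^ n"
      unfolding E using q0 by (simp add: R_def power2_eq_square field_simps)
    also have "R * (q + q\<^sup>2) = 1 + q"
      using q0 by (simp add: R_def power2_eq_square field_simps)
    finally have YY: "Y n + R * (\<Sum>l\<le>n. c l * Y l) = R * (\<Sum>l\<le>n. c l * (1 + 1))"
      using q0 by (simp add: mult_ac flip: sum_distrib_right)
    have "vlim (\<lambda>N. R * (\<Sum>l\<le>n. c l * T l N)) (R * (\<Sum>l\<le>n. c l * (1 + 1)))"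
      using T by (intro vlim_cmult vlim_sum)
    then have "vlim (\<lambda>N. fsum q (\<lambda>x. g x ^ n) N + R * (\<Sum>l\<le>n. c l * fsum q (\<lambda>x. g x ^ l) N))
        (Y n + R * (\<Sum>l\<le>n. c l * Y l))"
      unfolding X YY .
    then show "vlim (\<lambda>N. fsum q (\<lambda>x. g x ^ n) N
          + R * (\<Sum>l\<le>n. of_nat (n choose l) * R ^ l * fsum q (\<lambda>x. g x ^ l) N))
        (Y n + R * (\<Sum>l\<le>n. of_nat (n choose l) * R ^ l * Y l))"
      unfolding c_def .
  qed
  then show ?thesis
    by (simp add: g_def Y_def)
qed

section \<open>Evaluation of the two integrals\<close>

lemma has_fermionic_integral_q_bracket:
  assumes odd: "odd p" and R: "v (1 - R) < 1"
  shows "has_fermionic_integral v p R (\<lambda>x. q_bracket v R x ^ n) (q_euler R n)"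
proof -
  obtain f' where "udiff (q_bracket v R) f'"
    using udiff_q_bracket [OF R] by blast
  then obtain g' where g': "udiff (\<lambda>x. q_bracket v R x ^ n) g'"
    using udiff_power by blast
  show ?thesis
    using has_fermionic_integral_if_vlim_fsum [OF odd R g' vlim_fsum_q_bracket [OF odd R]]
      one_plus_power_nonzero [OF odd R, of 1] by simp
qed

lemma has_fermionic_integral_q_bracket_reflect:
  assumes odd: "odd p" and q: "v (1 - q) < 1" and n: "n \<ge> 1"
  shows "has_fermionic_integral v p q (\<lambda>x. q_bracket v (1 / q) (1 - x) ^ n)
    (1 + q + q\<^sup>2 * q_euler (1 / q) n)"
proof -
  obtain f' where "udiff (q_bracket v (1 / q)) f'"
    using udiff_q_bracket [OF v_one_minus_inverse [OF q]] by blast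
  then obtain g' where g': "udiff (\<lambda>x. q_bracket v (1 / q) (1 - x) ^ n) g'"
    using udiff_power [OF udiff_reflect] by blast
  have "1 + q \<noteq> 0"
    using one_plus_power_nonzero [OF odd q, of 1] by simp
  then have "(1 + q) / 2 * (2 / (1 + q)) = 1"
    by (simp only: times_divide_times_eq mult.commute [of "1 + q"]) (simp del: distrib_left_numeral)
  \<comment> \<open>For n >= 1 the correction term from the case n = 0 disappears.\<close>
  moreover have "(0 :: 'a) ^ n = 0"
    using n by (simp add: power_0_left)
  ultimately have "(1 + q) / 2 * (2 / (1 + q) * (1 + q + q\<^sup>2 * q_euler (1 / q) n - (q + q\<^sup>2) * 0 ^ n))
      = 1 + q + q\<^sup>2 * q_euler (1 / q) n"
    by (simp only: mult.assoc [symmetric]) simp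
  then show ?thesis
    using has_fermionic_integral_if_vlim_fsum [OF odd q g' vlim_fsum_q_bracket_reflect [OF odd q]]
    by (simp only:)
qed

end

theorem theorem5:
  fixes v :: "'a :: field_char_0 \<Rightarrow> real" and p :: nat and q :: 'a and n :: nat
  assumes "Factorial_Ring.prime p" and "odd p"
    and "padic_complex_field v p"
    and "v (1 - q) < 1"
    and "n \<ge> 1"
  shows "fermionic_integrable v p q (\<lambda>x. q_bracket v (1 / q) (1 - x) ^ n)
       \<and> fermionic_integrable v p (1 / q) (\<lambda>x. q_bracket v (1 / q) x ^ n)
       \<and> fermionic_integral v p q (\<lambda>x. q_bracket v (1 / q) (1 - x) ^ n)
           = q\<^sup>2 * fermionic_integral v p (1 / q) (\<lambda>x. q_bracket v (1 / q) x ^ n) + q + 1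
       \<and> q\<^sup>2 * fermionic_integral v p (1 / q) (\<lambda>x. q_bracket v (1 / q) x ^ n) + q + 1
           = q_bracket v q 2 + q\<^sup>2 * q_euler (1 / q) n"
proof -
  interpret padic_complex_field v p
    by fact
  note I = has_fermionic_integral_q_bracket_reflect [OF assms(2,4,5)]
    and J = has_fermionic_integral_q_bracket [OF assms(2) v_one_minus_inverse [OF assms(4)], of n]
  from I J have "fermionic_integrable v p q (\<lambda>x. q_bracket v (1 / q) (1 - x) ^ n)"
    "fermionic_integrable v p (1 / q) (\<lambda>x. q_bracket v (1 / q) x ^ n)"
    unfolding fermionic_integrable_def by blast+
  then show ?thesis
    by (simp add: fermionic_integral_eqI [OF I] fermionic_integral_eqI [OF J] q_bracket_2 [OF assms(4)])
qed

end
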